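(* For every $\tau\in\mathbb{H}^2$ set $$\tilde f(\tau)=\frac{-11+5\sqrt5}{2}\prod_{n=1}^{\infty}\frac{\left(1+\frac{1-\sqrt5}{2}q^n+q^{2n}\right)^5}{\left(1+\frac{1+\sqrt5}{2}q^n+q^{2n}\right)^5},\qquad q=\exp(2\pi i\tau),$$ and $$T(\tau)=\frac{\sqrt{250+110\sqrt5}}{5}\prod_{n=1}^{\infty}\frac{(1-q^n)^5}{(1-q^{5n})^3}\left(1+\frac{1+\sqrt5}{2}q^n+q^{2n}\right)^5 .$$ Then the inverse function $\tau=\tau(\tilde f)$ yields $T(\tilde f)=T(\tau(\tilde f))$, and $T(\tilde f)$ satisfies the differential equation $$\frac{d^2T}{d\tilde f^2}+\left\{\frac{1}{\tilde f}+\frac{1}{\tilde f-\frac{-11+5\sqrt5}{2}}+\frac{1}{\tilde f-\frac{-11-5\sqrt5}{2}}\right\}\frac{dT}{d\tilde f}+\frac{\tilde f+3}{\tilde f\left(\tilde f-\frac{-11+5\sqrt5}{2}\right)\left(\tilde f-\frac{-11-5\sqrt5}{2}\right)}\,T=0 .$$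
   Context: $\mathbb{H}^2=\{\tau\in\mathbb{C}\mid \Im\tau>0\}$. The inverse function $\tau=\tau(\tilde f)$ means any local holomorphic inverse of $\tau\mapsto \tilde f(\tau)$; thus $T$ is regarded locally as a function of the variable $\tilde f$. *)

theory Defs
  imports "HOL-Complex_Analysis.Complex_Analysis"
begin

definition upper_half_plane :: "complex set" where
  "upper_half_plane = {\<tau>. Im \<tau> > 0}"

definition nome :: "complex \<Rightarrow> complex" where
  "nome \<tau> = exp (2 * of_real pi * \<i> * \<tau>)"

definition sing_plus :: real where
  "sing_plus = (-11 + 5 * sqrt 5) / 2"

definition sing_minus :: real where
  "sing_minus = (-11 - 5 * sqrt 5) / 2"

(* In the two products below the library operator starts at n = 0,
   so the exponent n = 1, 2, ... is written Suc n. *)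

definition ftilde :: "complex \<Rightarrow> complex" where
  "ftilde \<tau> = (let q = nome \<tau> in
     of_real sing_plus *
     (\<Prod>n. (1 + of_real ((1 - sqrt 5) / 2) * q ^ Suc n + q ^ (2 * Suc n)) ^ 5 /
           (1 + of_real ((1 + sqrt 5) / 2) * q ^ Suc n + q ^ (2 * Suc n)) ^ 5))"

definition Tfun :: "complex \<Rightarrow> complex" where
  "Tfun \<tau> = (let q = nome \<tau> in
     of_real (sqrt (250 + 110 * sqrt 5) / 5) *
     (\<Prod>n. (1 - q ^ Suc n) ^ 5 / (1 - q ^ (5 * Suc n)) ^ 3 *
           (1 + of_real ((1 + sqrt 5) / 2) * q ^ Suc n + q ^ (2 * Suc n)) ^ 5))"

(* A right inverse of f on an open set U suffices: a holomorphic g with f (g w) = w is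
   injective on U, so g ` U is open and g is the two-sided inverse of f restricted to g ` U. *)

definition local_holomorphic_inverse ::
  "(complex \<Rightarrow> complex) \<Rightarrow> complex set \<Rightarrow> complex set \<Rightarrow> (complex \<Rightarrow> complex) \<Rightarrow> bool" where
  "local_holomorphic_inverse f D U g \<longleftrightarrow>
     open U \<and> g holomorphic_on U \<and> g ` U \<subseteq> D \<and> (\<forall>w\<in>U. f (g w) = w)"

end

theory Submission
  imports Defs "HOL-Real_Asymp.Real_Asymp"
begin

text \<open>Write \<open>q\<close> for the nome, \<open>\<theta>(s)\<close> for the odd theta function at \<open>exp s\<close>, and \<open>D = q d/dq\<close>.
Up to constants the two products are \<open>f = (\<theta>(s\<^sub>1) / \<theta>(s\<^sub>2))^5\<close>
and a quotient \<open>T\<close> of powers of \<open>\<theta>'(0)\<close>, \<open>\<theta>(s\<^sub>1)\<close> and \<open>\<theta>(s\<^sub>2)\<close>, where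
\<open>s\<^sub>1 = 2 \<pi> \<i> / 5\<close> and \<open>s\<^sub>2 = 2 s\<^sub>1\<close>: they are modular for \<open>\<Gamma>\<^sub>1(5)\<close>, of weights 0 and 1.
The proof works in the ring generated by the two Eisenstein series of weight one
\<open>x = - \<theta>'/\<theta>(s\<^sub>1)\<close> and \<open>y = - \<theta>'/\<theta>(s\<^sub>2)\<close> together with
\<open>e = E\<^sub>2/12\<close>, and shows that this ring is closed under \<open>D\<close>, with explicit cubic and
quartic polynomials (lemma \<open>eis_has_derivative\<close>).

One identity carries all of this. Let \<open>Z = - \<theta>'/\<theta>\<close> and let
\<open>\<Phi>\<close> be the logarithmic derivative, with respect to \<open>D\<close>, of the product
\<open>\<Prod>n. (1 - exp s q^n) (1 - exp (-s) q^n)\<close>. Then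
\<open>Z(s) Z(t) - (Z(s) + Z(t)) Z(s + t) + \<Phi>(s) + \<Phi>(t) + \<Phi>(s + t) = -1/4\<close>
(lemma \<open>zeta_addition\<close>). Expanded as a double Fourier series in a region of absolute convergence it
says no more than \<open>1/((1-a)(1-b)) = b/((b-a)(1-b)) + a/((a-b)(1-a))\<close> for each pair of exponents
in general position. Letting \<open>t\<close> tend to 0 gives the heat equation for \<open>\<theta>\<close>; putting \<open>t = s\<close> gives a
duplication formula. Both continue analytically to the unit circle. Since doubling permutes the points of
order five up to sign, the duplication formula and its first two derivatives at \<open>s\<^sub>1\<close> and
\<open>s\<^sub>2\<close> are linear equations for \<open>\<Phi>\<close>, \<open>\<Phi>'\<close> and \<open>\<Phi>''\<close> there. The heat equation
eliminates the derivatives of \<open>Z\<close> from them, and the solutions are polynomials in \<open>x, y, e\<close>.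
As \<open>D Z = - \<Phi>'\<close> and \<open>D Z' = - \<Phi>''\<close>, these determine the derivatives of
\<open>x, y, e\<close>.

The products enter only through their logarithmic derivatives. The forms \<open>3x + y\<close> and \<open>x - 3y\<close>
have the same ones as \<open>T\<close> and \<open>f T\<close>, so they are constant multiples of them, and the values at
\<open>q = 0\<close> fix the constants (lemma \<open>eis_eq_products\<close>). Hence \<open>f = (x - 3y)/(3x + y)\<close>,
\<open>D f = - 5 W f\<close> and \<open>f^2 + 11 f - 1 = 25 W / (3x + y)^2\<close> with \<open>W = x^2 - 4xy - y^2\<close>. The form \<open>W\<close>
also satisfies a first order linear equation in \<open>q\<close> and therefore has no zero in the upper half plane (lemma
\<open>wronskian_nonzero\<close>); this makes \<open>f\<close> locally invertible and keeps it away from the singular points,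
which are 0 and the roots of \<open>w^2 + 11 w - 1\<close>. In the variable \<open>w = f\<close> the operator \<open>d/dw\<close> is
\<open>- D / (5 W w)\<close>, and the differential equation for \<open>T\<close> becomes a polynomial identity in
\<open>x, y, e\<close> (lemma \<open>ode_identity\<close>).\<close>

section \<open>Lambert series in two variables\<close>

text \<open>One two-parameter family contains every series needed below: differentiation in \<open>s\<close> raises \<open>k\<close> by one, and
\<open>q d/dq\<close> turns \<open>j = 1\<close> into \<open>j = 2\<close> while raising \<open>k\<close> by one. The exponent \<open>k\<close> is an
integer because the logarithms of the products have \<open>k = -1\<close>. For \<open>j > 0\<close> the summand at \<open>n = 0\<close>
is \<open>1 / 0 = 0\<close>, so the sum is really over \<open>n \<ge> 1\<close>.\<close>

definition lambert :: "nat \<Rightarrow> int \<Rightarrow> complex \<Rightarrow> complex \<Rightarrow> complex" where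
  "lambert j k q s = (\<Sum>n. of_nat n powi k * exp (of_nat n * s) * (q ^ n / (1 - q ^ n) ^ j))"

lemma summable_power_times_geometric:
  fixes x :: real
  assumes "0 \<le> x" "x < 1"
  shows "summable (\<lambda>n. real n ^ m * x ^ n)"
proof -
  obtain y where y: "x < y" "y < 1" using dense assms by blast
  show ?thesis
  proof (cases "x = 0")
    case True
    then have "(\<lambda>n. real n ^ m * x ^ n) = (\<lambda>n. if n = 0 then real n ^ m else 0)"
      by (auto simp: fun_eq_iff)
    then show ?thesis by simp
  next
    case False
    then have x: "x > 0" using assms by simp
    have "(\<lambda>n. real n ^ m * x ^ n) \<in> O(\<lambda>n. y ^ n)"
      using x y by real_asymp
    moreover have "summable (\<lambda>n. norm (y ^ n))"
      using x y by (simp add: summable_geometric)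
    ultimately show ?thesis
      by (rule summable_comparison_test_bigo[rotated])
  qed
qed

lemma norm_of_nat_powi_le:
  "norm (of_nat n powi k :: complex) \<le> real n ^ nat \<bar>k\<bar> + 1"
proof (cases "n = 0")
  case False
  show ?thesis
  proof (cases "k \<ge> 0")
    case True
    then show ?thesis by (simp add: power_int_def norm_power)
  next
    case nk: False
    have "norm (of_nat n powi k :: complex) = 1 / real n ^ nat (- k)"
      using nk by (simp add: power_int_def norm_inverse norm_power divide_inverse power_inverse)
    also have "\<dots> \<le> 1" using False by (simp add: divide_le_eq_1)
    finally have "norm (of_nat n powi k :: complex) \<le> 1" .
    then show ?thesis by (simp add: add_increasing)
  qed
qed (auto simp: power_int_def norm_power)

lemma power_neq_1_of_norm_less_1:
  fixes q :: complex
  assumes "norm q < 1" "n > 0"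
  shows "q ^ n \<noteq> 1"
proof
  assume "q ^ n = 1"
  then have "norm q ^ n = 1" by (metis norm_one norm_power)
  moreover have "norm q ^ n < 1" using assms by (simp add: power_less_one_iff)
  ultimately show False by simp
qed

lemma norm_lambert_factor_le:
  fixes q :: complex
  assumes "norm q < 1" "j > 0"
  shows "norm (q ^ n / (1 - q ^ n) ^ j) \<le> norm q ^ n / (1 - norm q) ^ j"
proof (cases "n = 0")
  case False
  have "norm q ^ n \<le> norm q"
    using False assms by (metis norm_ge_zero power_decreasing power_one_right less_eq_real_def Suc_leI One_nat_def gr0I)
  then have "1 - norm q \<le> norm (1 - q ^ n)"
    using norm_triangle_ineq2[of 1 "q ^ n"] by (simp add: norm_power)
  then show ?thesis
    using assms by (auto simp: norm_divide norm_power intro!: divide_left_mono power_mono mult_pos_pos zero_less_power)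
qed (use assms in \<open>auto simp: zero_power\<close>)

lemma summable_norm_lambert:
  fixes q s :: complex
  assumes "norm q < 1" "norm (q * exp s) < 1" "j > 0"
  shows "summable (\<lambda>n. norm (of_nat n powi k * exp (of_nat n * s) * (q ^ n / (1 - q ^ n) ^ j)))"
proof (rule summable_comparison_test'[where N = 0])
  define x where "x = norm (q * exp s)"
  have x: "0 \<le> x" "x < 1" using assms by (auto simp: x_def)
  show "summable (\<lambda>n. (real n ^ nat \<bar>k\<bar> * x ^ n + real n ^ 0 * x ^ n) * (1 / (1 - norm q) ^ j))"
    by (intro summable_mult2 summable_add summable_power_times_geometric x)
  fix n :: nat
  have "norm (of_nat n powi k * exp (of_nat n * s) * (q ^ n / (1 - q ^ n) ^ j))
        \<le> (real n ^ nat \<bar>k\<bar> + 1) * norm (exp s) ^ n * (norm q ^ n / (1 - norm q) ^ j)"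
    unfolding norm_mult exp_of_nat_mult norm_power
    by (intro mult_mono norm_of_nat_powi_le norm_lambert_factor_le assms mult_nonneg_nonneg) auto
  then show "norm (norm (of_nat n powi k * exp (of_nat n * s) * (q ^ n / (1 - q ^ n) ^ j)))
      \<le> (real n ^ nat \<bar>k\<bar> * x ^ n + real n ^ 0 * x ^ n) * (1 / (1 - norm q) ^ j)"
    by (simp add: x_def norm_mult power_mult_distrib field_simps)
qed

lemma summable_lambert:
  fixes q s :: complex
  assumes "norm q < 1" "norm (q * exp s) < 1" "j > 0"
  shows "summable (\<lambda>n. of_nat n powi k * exp (of_nat n * s) * (q ^ n / (1 - q ^ n) ^ j))"
  using summable_norm_lambert[OF assms] by (rule summable_norm_cancel)

text \<open>Termwise differentiation on a half plane \<open>Re s < \<sigma>\<close>, on which the terms are dominated by those at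
\<open>\<sigma>\<close> itself.\<close>

lemma lambert_has_derivative_s:
  assumes q: "norm q < 1" and s: "norm (q * exp s) < 1" and j: "j > 0"
  shows "(lambert j k q has_field_derivative lambert j (k + 1) q s) (at s)"
proof -
  have "\<exists>\<sigma>. Re s < \<sigma> \<and> norm q * exp \<sigma> < 1"
  proof (cases "q = 0")
    case True then show ?thesis by (intro exI[of _ "Re s + 1"]) auto
  next
    case False
    have "exp (Re s) < exp (- ln (norm q))"
      using s False by (simp add: norm_mult exp_minus field_simps)
    then have "Re s < - ln (norm q)" by simp
    then obtain \<sigma> where \<sigma>: "Re s < \<sigma>" "\<sigma> < - ln (norm q)" using dense by blast
    have "exp \<sigma> < exp (- ln (norm q))" using \<sigma> by simp
    then show ?thesis using \<sigma> False by (intro exI[of _ \<sigma>]) (simp add: exp_minus field_simps)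
  qed
  then obtain \<sigma> where \<sigma>: "Re s < \<sigma>" "norm q * exp \<sigma> < 1" by blast
  define S where "S = {s. Re s < \<sigma>}"
  have S: "convex S" "open S" "s \<in> S"
    using \<sigma> by (auto simp: S_def convex_halfspace_Re_lt open_halfspace_Re_lt)
  define F where "F = (\<lambda>n s. of_nat n powi k * exp (of_nat n * s) * (q ^ n / (1 - q ^ n) ^ j))"
  define F' where "F' = (\<lambda>n s. of_nat n powi (k + 1) * exp (of_nat n * s) * (q ^ n / (1 - q ^ n) ^ j))"
  have "(\<lambda>s. \<Sum>n. F n s) = lambert j k q" "(\<Sum>n. F' n s) = lambert j (k + 1) q s"
    by (auto simp: F_def F'_def lambert_def fun_eq_iff)
  moreover have "((\<lambda>s. \<Sum>n. F n s) has_field_derivative (\<Sum>n. F' n s)) (at s)"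
  proof (rule has_field_derivative_series'(2)[where S = S and x0 = s])
    show "(F n has_field_derivative F' n t) (at t within S)" for n t
    proof (cases "n = 0")
      case False
      then show ?thesis
        using power_neq_1_of_norm_less_1[OF q, of n]
        unfolding F_def F'_def by (auto intro!: derivative_eq_intros simp: power_int_add)
    next
      case True
      then show ?thesis unfolding F_def F'_def using j by (simp add: zero_power)
    qed
    show "uniformly_convergent_on S (\<lambda>n x. \<Sum>i<n. F' i x)"
    proof (rule Weierstrass_m_test')
      define M where "M = (\<lambda>n. norm (of_nat n powi (k+1) * exp (of_nat n * complex_of_real \<sigma>) * (q ^ n / (1 - q ^ n) ^ j)))"
      show "summable M" unfolding M_def
        using \<sigma> q j by (intro summable_norm_lambert) (auto simp: norm_mult)
      show "norm (F' n x) \<le> M n" if "x \<in> S" for n x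
        unfolding F'_def M_def norm_mult exp_of_nat_mult norm_power norm_exp_eq_Re
        using that by (intro mult_right_mono mult_left_mono power_mono) (auto simp: S_def)
    qed
    show "summable (\<lambda>n. F n s)" unfolding F_def by (rule summable_lambert[OF q s j])
    show "s \<in> interior S" using S by (simp add: interior_open)
  qed (use S in auto)
  ultimately show ?thesis by simp
qed

text \<open>This is \<open>lambert 2 (k + 1) q s / q\<close> with the removable singularity at \<open>q = 0\<close> filled in; the value there
is what later shows that the Hauptmodul is not constant.\<close>

definition dlambert :: "int \<Rightarrow> complex \<Rightarrow> complex \<Rightarrow> complex" where
  "dlambert k q s = (\<Sum>n. of_nat n powi (k + 1) * exp (of_nat n * s) * (q ^ (n - 1) / (1 - q ^ n) ^ 2))"

lemma lambert_has_derivative_q: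
  assumes q: "norm q < 1" and s: "Re s = 0"
  shows "((\<lambda>q. lambert 1 k q s) has_field_derivative dlambert k q s) (at q)"
proof -
  obtain \<rho> where \<rho>: "norm q < \<rho>" "\<rho> < 1" using q dense by blast
  then have \<rho>0: "\<rho> > 0" by (meson le_less_trans norm_ge_zero)
  define S where "S = ball (0::complex) \<rho>"
  define F where "F = (\<lambda>n q. of_nat n powi k * exp (of_nat n * s) * (q ^ n / (1 - q ^ n) ^ 1))"
  define F' where "F' = (\<lambda>n q. of_nat n powi (k + 1) * exp (of_nat n * s) * (q ^ (n - 1) / (1 - q ^ n) ^ 2))"
  have "(\<lambda>q. \<Sum>n. F n q) = (\<lambda>q. lambert 1 k q s)" "(\<Sum>n. F' n q) = dlambert k q s"
    by (auto simp: F_def F'_def lambert_def dlambert_def fun_eq_iff)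
  moreover have "((\<lambda>q. \<Sum>n. F n q) has_field_derivative (\<Sum>n. F' n q)) (at q)"
  proof (rule has_field_derivative_series'(2)[where S = S and x0 = q])
    show "(F n has_field_derivative F' n t) (at t within S)" if "t \<in> S" for n t
    proof (cases "n = 0")
      case False
      have "t ^ n \<noteq> 1"
        using that \<rho> False by (intro power_neq_1_of_norm_less_1) (auto simp: S_def)
      then show ?thesis
        using False unfolding F_def F'_def
        by (auto intro!: derivative_eq_intros simp: power_int_add power2_eq_square) (simp add: field_simps power_eq_if)
    next
      case True
      then show ?thesis unfolding F_def F'_def by simp
    qed
    show "uniformly_convergent_on S (\<lambda>n x. \<Sum>i<n. F' i x)"
    proof (rule Weierstrass_m_test')
      define M where "M = (\<lambda>n. (real n ^ nat \<bar>k+1\<bar> * \<rho> ^ n + real n ^ 0 * \<rho> ^ n) * (1 / (\<rho> * (1 - \<rho>) ^ 2)))"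
      show "summable M" unfolding M_def
        by (intro summable_mult2 summable_add summable_power_times_geometric) (use \<rho> \<rho>0 in auto)
      show "norm (F' n x) \<le> M n" if "x \<in> S" for n x
      proof (cases "n = 0")
        case False
        have x: "norm x < \<rho>" using that by (auto simp: S_def)
        have "norm x ^ n \<le> norm x" 
          using False x \<rho> by (metis norm_ge_zero power_decreasing power_one_right less_eq_real_def Suc_leI One_nat_def gr0I less_trans)
        then have 1: "1 - \<rho> \<le> norm (1 - x ^ n)"
          using norm_triangle_ineq2[of 1 "x ^ n"] x by (simp add: norm_power)
        have "norm (F' n x) \<le> (real n ^ nat \<bar>k+1\<bar> + 1) * 1 * (\<rho> ^ (n - 1) / (1 - \<rho>) ^ 2)"
          unfolding F'_def norm_mult exp_of_nat_mult norm_power norm_divide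
          using s x 1 \<rho> \<rho>0 by (intro mult_mono norm_of_nat_powi_le frac_le power_mono zero_less_power) auto
        also have "\<dots> = M n"
        proof -
          have "\<rho> ^ n = \<rho> * \<rho> ^ (n - 1)" using False by (cases n) auto
          then show ?thesis using \<rho>0 by (simp add: M_def divide_simps) (simp add: algebra_simps)
        qed
        finally show ?thesis .
      qed (use \<rho>0 in \<open>auto simp: F'_def M_def\<close>)
    qed
    show "summable (\<lambda>n. F n q)" unfolding F_def using q s by (intro summable_lambert) (auto simp: norm_mult)
    show "q \<in> interior S" using \<rho> by (simp add: S_def interior_open)
  qed (use \<rho> in \<open>auto simp: S_def\<close>)
  ultimately show ?thesis by simp
qed

lemma times_dlambert:
  assumes "norm q < 1" and s: "Re s = 0"
  shows "q * dlambert k q s = lambert 2 (k + 1) q s"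
proof (cases "q = 0")
  case True
  have "of_nat n powi (k+1) * exp (of_nat n * s) * ((0::complex) ^ n / (1 - 0 ^ n)\<^sup>2) = 0" for n
    by (cases n) auto
  then show ?thesis unfolding True lambert_def by (simp only: suminf_zero mult_zero_left)
next
  case False
  have "q * (of_nat n powi (k + 1) * exp (of_nat n * s) * (q ^ (n - 1) / (1 - q ^ n) ^ 2))
      = of_nat n powi (k + 1) * exp (of_nat n * s) * (q ^ n / (1 - q ^ n) ^ 2)" for n
    by (cases n) auto
  note * = this
  have sm: "summable (\<lambda>n. of_nat n powi (k + 1) * exp (of_nat n * s) * (q ^ n / (1 - q ^ n) ^ 2))"
    using assms by (intro summable_lambert) (auto simp: norm_mult)
  have "summable (\<lambda>n. inverse q * (of_nat n powi (k + 1) * exp (of_nat n * s) * (q ^ n / (1 - q ^ n) ^ 2)))"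
    by (rule summable_mult[OF sm])
  then have "summable (\<lambda>n. of_nat n powi (k + 1) * exp (of_nat n * s) * (q ^ (n - 1) / (1 - q ^ n) ^ 2))"
    unfolding *[symmetric] by (simp only: mult.assoc[symmetric] left_inverse[OF False] mult_1_left)
  then show ?thesis
    unfolding dlambert_def lambert_def by (subst suminf_mult[symmetric]) (simp_all only: *)
qed

lemma dlambert_0: "dlambert k 0 s = exp s"
proof -
  have "(\<lambda>n. of_nat n powi (k + 1) * exp (of_nat n * s) * ((0::complex) ^ (n - 1) / (1 - 0 ^ n) ^ 2))
       = (\<lambda>n. if n = 1 then exp s else 0)"
  proof
    fix n :: nat
    show "of_nat n powi (k + 1) * exp (of_nat n * s) * ((0::complex) ^ (n - 1) / (1 - 0 ^ n) ^ 2)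
       = (if n = 1 then exp s else 0)"
    proof (cases "n \<le> 1")
      case True
      then have "n = 0 \<or> n = 1" by auto
      then show ?thesis by auto
    next
      case False
      then have "(0::complex) ^ (n - 1) = 0" by simp
      then show ?thesis using False by simp
    qed
  qed
  then show ?thesis
    unfolding dlambert_def using sums_unique[OF sums_single[of 1 "\<lambda>_. exp s"]] by simp
qed

lemma lambert_0 [simp]: "j > 0 \<Longrightarrow> lambert j k 0 s = 0"
proof -
  assume "j > 0"
  then have "of_nat n powi k * exp (of_nat n * s) * ((0::complex) ^ n / (1 - 0 ^ n) ^ j) = 0" for n
    by (cases n) auto
  then show ?thesis by (simp only: lambert_def suminf_zero)
qed

section \<open>The addition formula, by comparing Fourier coefficients\<close>

text \<open>The index 0 occurs in both halves, hence the correction \<open>- f 0\<close>.\<close>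

lemma has_sum_int_split:
  fixes f :: "int \<Rightarrow> 'a::banach"
  assumes "summable (\<lambda>n. norm (f (int n)))" "summable (\<lambda>n. norm (f (- int n)))"
  shows "(f has_sum ((\<Sum>n. f (int n)) + (\<Sum>n. f (- int n)) - f 0)) UNIV"
proof -
  have 1: "(f has_sum (\<Sum>n. f (int n))) {0..}"
  proof -
    have "((\<lambda>n. f (int n)) has_sum (\<Sum>n. f (int n))) UNIV"
      by (rule norm_summable_imp_has_sum[OF assms(1) summable_sums[OF summable_norm_cancel[OF assms(1)]]])
    moreover have "bij_betw int UNIV {0..}"
      by (rule bij_betwI[of _ _ _ nat]) auto
    ultimately show ?thesis by (simp add: has_sum_reindex_bij_betw[of int UNIV "{0..}" f])
  qed
  have 2: "(f has_sum ((\<Sum>n. f (- int n)) - f 0)) {..<0}"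
  proof -
    have sm: "summable (\<lambda>n. norm (f (- int (Suc n))))"
      using assms(2) by (subst summable_Suc_iff[of "\<lambda>n. norm (f (- int n))"])
    have "((\<lambda>n. f (- int (Suc n))) has_sum (\<Sum>n. f (- int (Suc n)))) UNIV"
      by (rule norm_summable_imp_has_sum[OF sm summable_sums[OF summable_norm_cancel[OF sm]]])
    also have "(\<Sum>n. f (- int (Suc n))) = (\<Sum>n. f (- int n)) - f 0"
      using suminf_split_head[OF summable_norm_cancel[OF assms(2)]] by simp
    finally have "((\<lambda>n. f (- int (Suc n))) has_sum (\<Sum>n. f (- int n)) - f 0) UNIV" .
    moreover have "bij_betw (\<lambda>n. - int (Suc n)) UNIV {..<0}"
      by (rule bij_betwI[of _ _ _ "\<lambda>m. nat (- m - 1)"]) auto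
    ultimately show ?thesis using has_sum_reindex_bij_betw[of "\<lambda>n. - int (Suc n)" UNIV "{..<0}" f] by blast
  qed
  have "(f has_sum ((\<Sum>n. f (int n)) + ((\<Sum>n. f (- int n)) - f 0))) ({0..} \<union> {..<0})"
    by (rule has_sum_Un_disjoint[OF 1 2]) auto
  moreover have "{0..} \<union> {..<0} = (UNIV :: int set)" by auto
  ultimately show ?thesis by (simp add: algebra_simps)
qed

lemma norm_summable_on_int_split:
  fixes f :: "int \<Rightarrow> 'a::banach"
  assumes "summable (\<lambda>n. norm (f (int n)))" "summable (\<lambda>n. norm (f (- int n)))"
  shows "(\<lambda>n. norm (f n)) summable_on UNIV"
  using has_sum_int_split[of "\<lambda>n. norm (f n)"] assms by (auto simp: summable_on_def)

lemma has_sum_diff: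
  fixes f g :: "'a \<Rightarrow> complex"
  assumes "(f has_sum a) A" "(g has_sum b) A"
  shows "((\<lambda>x. f x - g x) has_sum (a - b)) A"
  using has_sum_add[OF assms(1) has_sum_cmult_right[OF assms(2), of "-1"]] by simp

lemma has_sum_product:
  fixes f :: "'a \<Rightarrow> complex" and g :: "'b \<Rightarrow> complex"
  assumes f: "(f has_sum a) A" "(\<lambda>x. norm (f x)) summable_on A" and g: "(g has_sum b) B" "(\<lambda>x. norm (g x)) summable_on B"
  shows "((\<lambda>(x, y). f x * g y) has_sum (a * b)) (A \<times> B)"
proof (rule has_sum_SigmaI[where g = "\<lambda>x. f x * b"])
  show "((\<lambda>y. case (x, y) of (x, y) \<Rightarrow> f x * g y) has_sum f x * b) B" for x
    using has_sum_cmult_right[OF g(1)] by simp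
  show "((\<lambda>x. f x * b) has_sum a * b) A" by (rule has_sum_cmult_left[OF f(1)])
  have "(\<lambda>p. norm (case p of (x, y) \<Rightarrow> f x * g y)) summable_on A \<times> B"
    using f(2) g(2)
    by (subst Infinite_Sum.abs_summable_on_Sigma_iff)
       (auto simp: norm_mult infsum_cmult_right' abs_mult abs_of_nonneg[OF infsum_nonneg] intro: summable_on_cmult_right summable_on_cmult_left)
  then show "(\<lambda>(x, y). f x * g y) summable_on A \<times> B" by (rule abs_summable_summable)
qed

text \<open>Minus the logarithmic derivative in \<open>s\<close> of the odd theta function: with \<open>u = exp s\<close> it is
\<open>1/2 (1 + u)/(1 - u) + (\<Sum>n\<ge>1. q^n/(1 - q^n) (u^n - u^(-n)))\<close>, an odd function with simple poles at the lattice
points and convergent for \<open>|q| < |u| < 1/|q|\<close>.\<close>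

definition zetaq :: "complex \<Rightarrow> complex \<Rightarrow> complex" where
  "zetaq q s = (1 + exp s) / (2 * (1 - exp s)) + lambert 1 0 q s - lambert 1 0 q (- s)"

text \<open>The \<open>q d/dq\<close>-logarithmic derivative of \<open>\<Prod>n\<ge>1. (1 - exp s q^n) (1 - exp (-s) q^n)\<close>.\<close>

definition phiq :: "complex \<Rightarrow> complex \<Rightarrow> complex" where
  "phiq q s = - (lambert 2 0 q s + lambert 2 0 q (- s))"

text \<open>For \<open>|q| < |exp s| < 1\<close> the geometric series absorbs the polar part of \<open>zetaq\<close>, and its Fourier
coefficients take the uniform shape \<open>1/(1 - q^n)\<close>, with \<open>1/2\<close> at \<open>n = 0\<close>.\<close>

definition zcoeff :: "complex \<Rightarrow> int \<Rightarrow> complex" where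
  "zcoeff q n = (if n = 0 then 1 / 2 else 1 / (1 - q powi n))"

definition gcoeff :: "complex \<Rightarrow> int \<Rightarrow> complex" where
  "gcoeff q n = q powi n / (1 - q powi n) ^ 2"

lemma gcoeff_0 [simp]: "gcoeff q 0 = 0"
  by (simp add: gcoeff_def)

locale annulus =
  fixes q s :: complex
  assumes q: "q \<noteq> 0" "norm q < 1" and s: "Re s < 0" "norm q < norm (exp s)"
begin

lemma norm_exp_s: "norm (exp s) < 1" "exp s \<noteq> 1" "norm (q * exp s) < 1" "norm (q * exp (- s)) < 1"
proof -
  show 1: "norm (exp s) < 1" using s by simp
  then show "exp s \<noteq> 1" by (metis less_irrefl norm_one)
  show "norm (q * exp s) < 1"
    using q 1 by (metis mult_strict_mono norm_ge_zero norm_mult mult_1 zero_less_one)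
  show "norm (q * exp (- s)) < 1"
    using s by (simp add: exp_minus norm_divide divide_inverse[symmetric] del: norm_exp_eq_Re)
qed

lemma zetaq_has_sum:
  "((\<lambda>n. zcoeff q n * exp (of_int n * s)) has_sum zetaq q s) UNIV"
  "(\<lambda>n. norm (zcoeff q n * exp (of_int n * s))) summable_on UNIV"
proof -
  define f where "f = (\<lambda>n. zcoeff q n * exp (of_int n * s))"
  define a where "a = (\<lambda>n. of_nat n powi 0 * exp (of_nat n * s) * (q ^ n / (1 - q ^ n) ^ 1))"
  define b where "b = (\<lambda>n. of_nat n powi 0 * exp (of_nat n * - s) * (q ^ n / (1 - q ^ n) ^ 1))"
  define h where "h = (\<lambda>n::nat. if n = 0 then 1 / 2 else (0::complex))"
  have fp: "f (int n) = exp s ^ n + a n - h n" for n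
  proof (cases "n = 0")
    case False
    then have "q ^ n \<noteq> 1" using q by (intro power_neq_1_of_norm_less_1) auto
    then show ?thesis using False
      by (simp add: f_def a_def h_def zcoeff_def power_int_def exp_of_nat_mult) (simp add: field_simps)
  qed (auto simp: f_def a_def h_def zcoeff_def)
  have fm: "f (- int n) = h n - b n" for n
  proof (cases "n = 0")
    case False
    then have 1: "q ^ n \<noteq> 1" using q by (intro power_neq_1_of_norm_less_1) auto
    have 2: "1 / (1 - inverse (q ^ n)) = - (q ^ n / (1 - q ^ n))"
      using q 1 by (simp add: field_simps)
    show ?thesis using False 
      by (simp add: f_def b_def h_def zcoeff_def power_int_def power_inverse 2)
  qed (auto simp: f_def b_def h_def zcoeff_def)
  have a: "summable (\<lambda>n. norm (a n))" and b: "summable (\<lambda>n. norm (b n))"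
    unfolding a_def b_def by (intro summable_norm_lambert q norm_exp_s; simp)+
  have h: "h sums (1 / 2)" "summable (\<lambda>n. norm (h n))"
  proof -
    show "h sums (1 / 2)" unfolding h_def using sums_single[of 0 "\<lambda>_. 1/2::complex"] by simp
    have "(\<lambda>n. norm (h n)) = (\<lambda>n. if n = 0 then 1 / 2 else 0)" by (auto simp: h_def)
    then show "summable (\<lambda>n. norm (h n))" by simp
  qed
  have e: "summable (\<lambda>n. norm (exp s ^ n))" "(\<lambda>n. exp s ^ n) sums (1 / (1 - exp s))"
    using norm_exp_s by (auto simp: norm_power summable_geometric intro: geometric_sums simp del: norm_exp_eq_Re)
  have sp: "summable (\<lambda>n. norm (f (int n)))"
  proof (rule summable_comparison_test'[where N = 0])
    show "summable (\<lambda>n. norm (exp s ^ n) + norm (a n) + norm (h n))"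
      by (intro summable_add e a h)
    show "norm (norm (f (int n))) \<le> norm (exp s ^ n) + norm (a n) + norm (h n)" for n
      unfolding fp by (simp add: norm_triangle_le_diff norm_triangle_le del: norm_exp_eq_Re)
  qed
  have sm: "summable (\<lambda>n. norm (f (- int n)))"
  proof (rule summable_comparison_test'[where N = 0])
    show "summable (\<lambda>n. norm (h n) + norm (b n))"
      by (intro summable_add h b)
    show "norm (norm (f (- int n))) \<le> norm (h n) + norm (b n)" for n
      unfolding fm by (simp add: norm_triangle_le_diff)
  qed
  have ab: "a sums lambert 1 0 q s" "b sums lambert 1 0 q (- s)"
    unfolding a_def b_def lambert_def by (intro summable_sums summable_lambert q norm_exp_s; simp)+
  have "(\<lambda>n. f (int n)) sums (1 / (1 - exp s) + lambert 1 0 q s - 1 / 2)"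
            "(\<lambda>n. f (- int n)) sums (1 / 2 - lambert 1 0 q (- s))"
    unfolding fp fm
    by (rule sums_diff[OF sums_add[OF e(2) ab(1)] h(1)], rule sums_diff[OF h(1) ab(2)])
  moreover have "f 0 = 1 / 2" by (simp add: f_def zcoeff_def)
  moreover have "1 / (1 - exp s) - 1 / 2 = (1 + exp s) / (2 * (1 - exp s))"
    using norm_exp_s(2) by (simp add: field_simps)
  ultimately have "(\<Sum>n. f (int n)) + (\<Sum>n. f (- int n)) - f 0 = zetaq q s"
    unfolding zetaq_def by (simp only: sums_iff) (simp add: algebra_simps)
  then have "(f has_sum zetaq q s) UNIV"
    using has_sum_int_split[OF sp sm] by simp
  then show "((\<lambda>n. zcoeff q n * exp (of_int n * s)) has_sum zetaq q s) UNIV"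
    by (simp add: f_def)
  show "(\<lambda>n. norm (zcoeff q n * exp (of_int n * s))) summable_on UNIV"
    using norm_summable_on_int_split[OF sp sm] by (simp add: f_def)
qed

lemma phiq_has_sum: "((\<lambda>n. - gcoeff q n * exp (of_int n * s)) has_sum phiq q s) UNIV"
proof -
  define f where "f = (\<lambda>n. - gcoeff q n * exp (of_int n * s))"
  have fp: "f (int n) = - (of_nat n powi 0 * exp (of_nat n * s) * (q ^ n / (1 - q ^ n) ^ 2))" for n
    by (simp add: f_def gcoeff_def power_int_def)
  have fm: "f (- int n) = - (of_nat n powi 0 * exp (of_nat n * - s) * (q ^ n / (1 - q ^ n) ^ 2))" for n
  proof (cases "n = 0")
    case False
    then have 1: "q ^ n \<noteq> 1" using q by (intro power_neq_1_of_norm_less_1) auto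
    have 2: "inverse (q ^ n) * e / (1 - inverse (q ^ n)) ^ 2 = e * q ^ n / (1 - q ^ n) ^ 2" for e
      using q 1 by (simp add: field_simps power2_eq_square)
    show ?thesis using False 2
      by (simp add: f_def gcoeff_def power_int_def power_inverse)
  qed (auto simp: f_def gcoeff_def)
  have sp: "summable (\<lambda>n. norm (f (int n)))" and sm: "summable (\<lambda>n. norm (f (- int n)))"
    unfolding fp fm norm_minus_cancel by (intro summable_norm_lambert q norm_exp_s; simp)+
  have "(\<lambda>n. f (int n)) sums (- lambert 2 0 q s)"
            "(\<lambda>n. f (- int n)) sums (- lambert 2 0 q (- s))"
    unfolding fp fm lambert_def by (intro sums_minus summable_sums summable_lambert q norm_exp_s; simp)+
  moreover have "f 0 = 0" by (simp add: f_def)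
  ultimately have "(f has_sum phiq q s) UNIV"
    using has_sum_int_split[OF sp sm] by (simp add: phiq_def sums_iff)
  then show ?thesis by (simp add: f_def)
qed

end

text \<open>The addition formula at the level of Fourier coefficients. For nonzero \<open>m \<noteq> n\<close> it is a partial fraction identity in
\<open>q^m\<close> and \<open>q^n\<close>; the exceptional index pairs are those that produce the three \<open>\<Phi>\<close>-terms and the constant.\<close>

lemma zcoeff_relation:
  assumes q: "q \<noteq> 0" "norm q < 1"
  shows "zcoeff q m * zcoeff q n - zcoeff q (m - n) * zcoeff q n - zcoeff q (n - m) * zcoeff q m
         + (if n = 0 then - gcoeff q m else 0) + (if m = 0 then - gcoeff q n else 0)
         + (if m = n then - gcoeff q m else 0) = (if m = 0 \<and> n = 0 then - (1 / 4) else 0)"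
proof -
  have ne: "q powi k \<noteq> 1" if "k \<noteq> 0" for k
  proof
    assume *: "q powi k = 1"
    have "q ^ nat \<bar>k\<bar> = 1"
      using * by (cases "k \<ge> 0") (auto simp: power_int_def power_inverse)
    then show False using power_neq_1_of_norm_less_1[of q "nat \<bar>k\<bar>"] q that by auto
  qed
  have nz: "q powi k \<noteq> 0" for k using q by simp
  define a b where "a = q powi m" and "b = q powi n"
  have d: "q powi (m - n) = a / b" "q powi (n - m) = b / a"
    using q by (simp_all add: a_def b_def power_int_diff)
  have minus: "q powi (- k) = 1 / q powi k" for k by (simp add: power_int_minus divide_inverse)
  consider "m = 0" "n = 0" | "m = 0" "n \<noteq> 0" | "m \<noteq> 0" "n = 0" | "m \<noteq> 0" "n = m" | "m \<noteq> 0" "n \<noteq> 0" "m \<noteq> n" by blast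
  then show ?thesis
  proof cases
    case 2
    then show ?thesis using ne[of n] nz[of n]
      by (simp add: zcoeff_def gcoeff_def minus divide_simps) (simp add: algebra_simps power2_eq_square)
  next
    case 3
    then show ?thesis using ne[of m] nz[of m]
      by (simp add: zcoeff_def gcoeff_def minus divide_simps) (simp add: algebra_simps power2_eq_square)
  next
    case 4
    then show ?thesis using ne[of m] nz[of m]
      by (simp add: zcoeff_def gcoeff_def divide_simps) (simp add: algebra_simps power2_eq_square)
  next
    case 5
    have ab: "a \<noteq> 0" "b \<noteq> 0" "a \<noteq> 1" "b \<noteq> 1" using 5 ne nz by (auto simp: a_def b_def)
    have "a \<noteq> b" using ne[of "m - n"] 5 ab d by auto
    have "1 / (1 - a / b) = - (b / (a - b))" "1 / (1 - b / a) = a / (a - b)"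
      using ab \<open>a \<noteq> b\<close> by (simp_all add: field_simps)
    then have "1 / (1 - a) * (1 / (1 - b)) - 1 / (1 - a / b) * (1 / (1 - b)) - 1 / (1 - b / a) * (1 / (1 - a)) = 0"
      using ab \<open>a \<noteq> b\<close> by (simp add: divide_simps) (simp add: algebra_simps)
    then show ?thesis using 5 by (simp add: zcoeff_def d flip: a_def b_def)
  qed (simp add: zcoeff_def)
qed

text \<open>All three products are double Fourier series in \<open>exp (m s + n t)\<close> after reindexing, because
\<open>exp (a s + b (s + t))\<close> has \<open>m = a + b\<close> and \<open>n = b\<close>. The terms \<open>\<Phi>(s)\<close>, \<open>\<Phi>(t)\<close> and
\<open>\<Phi>(s + t)\<close> live on the lines \<open>n = 0\<close>, \<open>m = 0\<close> and \<open>m = n\<close>. The left half plane is needed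
for absolute convergence.\<close>

lemma zeta_addition:
  assumes q: "q \<noteq> 0" "norm q < 1" and st: "Re s < 0" "Re t < 0" "norm q < norm (exp (s + t))"
  shows "zetaq q s * zetaq q t - (zetaq q s + zetaq q t) * zetaq q (s + t)
         + phiq q s + phiq q t + phiq q (s + t) = - (1 / 4)"
proof -
  have le: "norm (exp (s + t)) \<le> norm (exp s)" "norm (exp (s + t)) \<le> norm (exp t)"
    using st by auto
  interpret S: annulus q s using q st less_le_trans[OF st(3) le(1)] by unfold_locales
  interpret T: annulus q t using q st less_le_trans[OF st(3) le(2)] by unfold_locales
  interpret ST: annulus q "s + t" using q st by unfold_locales auto
  define E where "E = (\<lambda>(m::int, n::int). exp (of_int m * s + of_int n * t))"
  have E0: "E (m, 0) = exp (of_int m * s)" "E (0, n) = exp (of_int n * t)" for m n by (simp_all add: E_def)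
  have En: "E (n, n) = exp (of_int n * (s + t))" for n by (simp add: E_def algebra_simps)
  have "((\<lambda>(m, n). (zcoeff q m * exp (of_int m * s)) * (zcoeff q n * exp (of_int n * t))) has_sum (zetaq q s * zetaq q t)) (UNIV \<times> UNIV)"
    by (intro has_sum_product S.zetaq_has_sum T.zetaq_has_sum)
  then have 1: "((\<lambda>(m, n). zcoeff q m * zcoeff q n * E (m, n)) has_sum (zetaq q s * zetaq q t)) UNIV"
    by (simp add: E_def exp_add algebra_simps)
  have "((\<lambda>(m, n). (zcoeff q m * exp (of_int m * s)) * (zcoeff q n * exp (of_int n * (s + t)))) has_sum (zetaq q s * zetaq q (s + t))) (UNIV \<times> UNIV)"
    by (intro has_sum_product S.zetaq_has_sum ST.zetaq_has_sum)
  then have "((\<lambda>(m, n). zcoeff q (m - n) * zcoeff q n * E (m, n)) has_sum (zetaq q s * zetaq q (s + t))) UNIV"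
    by (subst has_sum_reindex_bij_witness[where j = "\<lambda>(m, n). (m + n, n)" and i = "\<lambda>(m, n). (m - n, n)", symmetric])
       (auto simp: E_def algebra_simps simp flip: exp_add)
  note 2 = this
  have "((\<lambda>(m, n). (zcoeff q m * exp (of_int m * t)) * (zcoeff q n * exp (of_int n * (s + t)))) has_sum (zetaq q t * zetaq q (s + t))) (UNIV \<times> UNIV)"
    by (intro has_sum_product T.zetaq_has_sum ST.zetaq_has_sum)
  then have 3: "((\<lambda>(m, n). zcoeff q (n - m) * zcoeff q m * E (m, n)) has_sum (zetaq q t * zetaq q (s + t))) UNIV"
    by (subst has_sum_reindex_bij_witness[where j = "\<lambda>(m, n). (n, m + n)" and i = "\<lambda>(m, n). (n - m, m)", symmetric])
       (auto simp: E_def algebra_simps simp flip: exp_add)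
  have 4: "((\<lambda>(m, n). (if n = 0 then - gcoeff q m else 0) * E (m, n)) has_sum phiq q s) UNIV"
  proof -
    have "bij_betw (\<lambda>m. (m, 0::int)) UNIV (UNIV \<times> {0::int})" by (rule bij_betwI[of _ _ _ fst]) auto
    then have "((\<lambda>(m, n). - gcoeff q m * E (m, n)) has_sum phiq q s) (UNIV \<times> {0})"
      using S.phiq_has_sum by (subst has_sum_reindex_bij_betw[symmetric]) (auto simp: E0)
    then show ?thesis by (rule has_sum_cong_neutral[THEN iffD1, rotated -1]) (auto split: if_splits)
  qed
  have 5: "((\<lambda>(m, n). (if m = 0 then - gcoeff q n else 0) * E (m, n)) has_sum phiq q t) UNIV"
  proof -
    have "bij_betw (\<lambda>m. (0::int, m)) UNIV ({0::int} \<times> UNIV)" by (rule bij_betwI[of _ _ _ snd]) auto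
    then have "((\<lambda>(m, n). - gcoeff q n * E (m, n)) has_sum phiq q t) ({0} \<times> UNIV)"
      using T.phiq_has_sum by (subst has_sum_reindex_bij_betw[symmetric]) (auto simp: E0)
    then show ?thesis by (rule has_sum_cong_neutral[THEN iffD1, rotated -1]) (auto split: if_splits)
  qed
  have 6: "((\<lambda>(m, n). (if m = n then - gcoeff q m else 0) * E (m, n)) has_sum phiq q (s + t)) UNIV"
  proof -
    have "bij_betw (\<lambda>m::int. (m, m)) UNIV {(m, n). m = n}" by (rule bij_betwI[of _ _ _ snd]) auto
    then have "((\<lambda>(m, n). - gcoeff q m * E (m, n)) has_sum phiq q (s + t)) {(m, n). m = n}"
      using ST.phiq_has_sum by (subst has_sum_reindex_bij_betw[symmetric]) (auto simp: En)
    then show ?thesis by (rule has_sum_cong_neutral[THEN iffD1, rotated -1]) (auto split: if_splits)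
  qed
  have "((\<lambda>p. (case p of (m, n) \<Rightarrow> zcoeff q m * zcoeff q n * E (m, n))
          - (case p of (m, n) \<Rightarrow> zcoeff q (m - n) * zcoeff q n * E (m, n))
          - (case p of (m, n) \<Rightarrow> zcoeff q (n - m) * zcoeff q m * E (m, n))
          + (case p of (m, n) \<Rightarrow> (if n = 0 then - gcoeff q m else 0) * E (m, n))
          + (case p of (m, n) \<Rightarrow> (if m = 0 then - gcoeff q n else 0) * E (m, n))
          + (case p of (m, n) \<Rightarrow> (if m = n then - gcoeff q m else 0) * E (m, n))) has_sum
        (zetaq q s * zetaq q t - zetaq q s * zetaq q (s + t) - zetaq q t * zetaq q (s + t)
         + phiq q s + phiq q t + phiq q (s + t))) UNIV" (is "(?f has_sum ?S) UNIV")
    by (intro has_sum_add has_sum_diff 1 2 3 4 5 6)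
  moreover have "?f = (\<lambda>p. if p = (0, 0) then - (1 / 4) else 0)"
  proof
    fix p :: "int \<times> int"
    obtain m n where p: "p = (m, n)" by fastforce
    have "?f p = (zcoeff q m * zcoeff q n - zcoeff q (m - n) * zcoeff q n - zcoeff q (n - m) * zcoeff q m
         + (if n = 0 then - gcoeff q m else 0) + (if m = 0 then - gcoeff q n else 0)
         + (if m = n then - gcoeff q m else 0)) * E (m, n)"
      unfolding p prod.case by (simp only: ring_distribs)
    also have "\<dots> = (if m = 0 \<and> n = 0 then - (1 / 4) else 0) * E (m, n)"
      by (simp only: zcoeff_relation[OF q])
    finally show "?f p = (if p = (0, 0) then - (1 / 4) else 0)" by (auto simp: p E_def)
  qed
  moreover have "((\<lambda>p::int\<times>int. if p = (0, 0) then - (1 / 4) else 0) has_sum (- (1 / 4) :: complex)) UNIV"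
    by (rule has_sum_finite_neutralI[where B = "{(0, 0)}"]) auto
  ultimately have "?S = - (1 / 4)" by (simp only: has_sum_unique)
  then show ?thesis by (simp add: algebra_simps)
qed

section \<open>Heat equation and duplication formulas on the unit circle\<close>

definition dzetaq :: "complex \<Rightarrow> complex \<Rightarrow> complex" where
  "dzetaq q s = exp s / (1 - exp s) ^ 2 + lambert 1 1 q s + lambert 1 1 q (- s)"

definition dphiq :: "complex \<Rightarrow> complex \<Rightarrow> complex" where
  "dphiq q s = - (lambert 2 1 q s - lambert 2 1 q (- s))"

definition ddphiq :: "complex \<Rightarrow> complex \<Rightarrow> complex" where
  "ddphiq q s = - (lambert 2 2 q s + lambert 2 2 q (- s))"

definition strip :: "complex \<Rightarrow> complex set" where
  "strip q = {s. norm (q * exp s) < 1 \<and> norm (q * exp (- s)) < 1}"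

lemma open_strip: "open (strip q)"
  unfolding strip_def by (intro open_Collect_conj open_Collect_less continuous_intros)

lemma imaginary_in_strip: "norm q < 1 \<Longrightarrow> Re s = 0 \<Longrightarrow> s \<in> strip q"
  by (simp add: strip_def norm_mult)

lemma strip_norm_less:
  assumes "s \<in> strip q"
  shows "norm q < norm (exp s)"
proof -
  have "norm q / norm (exp s) < 1"
    using assms by (simp add: strip_def exp_minus norm_divide flip: divide_inverse del: norm_exp_eq_Re)
  then show ?thesis by (simp add: divide_less_eq del: norm_exp_eq_Re)
qed

lemma lambert_minus_has_derivative_s:
  assumes "norm q < 1" "norm (q * exp (- s)) < 1" "j > 0"
  shows "((\<lambda>s. lambert j k q (- s)) has_field_derivative - lambert j (k + 1) q (- s)) (at s)"
  using DERIV_chain2[where g = "\<lambda>s. - s" and x = s and s = UNIV, OF lambert_has_derivative_s[OF assms, of k] DERIV_minus[OF DERIV_ident]]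
  by simp

context
  fixes q :: complex
  assumes q: "norm q < 1"
begin

lemma zetaq_has_derivative:
  assumes "s \<in> strip q" "exp s \<noteq> 1"
  shows "(zetaq q has_field_derivative dzetaq q s) (at s)"
proof -
  have s: "norm (q * exp s) < 1" "norm (q * exp (- s)) < 1" using assms by (auto simp: strip_def)
  have "((\<lambda>s. (1 + exp s) / (2 * (1 - exp s))) has_field_derivative exp s / (1 - exp s) ^ 2) (at s)"
    using assms(2)
    apply (auto intro!: derivative_eq_intros)
    apply (simp add: divide_simps power2_eq_square)
    apply (simp add: algebra_simps)
    done
  from DERIV_diff[OF DERIV_add[OF this lambert_has_derivative_s[OF q s(1), of 1 0]] lambert_minus_has_derivative_s[OF q s(2), of 1 0]]
  show ?thesis unfolding zetaq_def[abs_def] dzetaq_def by simp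
qed

lemma phiq_has_derivative:
  assumes "s \<in> strip q"
  shows "(phiq q has_field_derivative dphiq q s) (at s)"
proof -
  have s: "norm (q * exp s) < 1" "norm (q * exp (- s)) < 1" using assms by (auto simp: strip_def)
  from DERIV_minus[OF DERIV_add[OF lambert_has_derivative_s[OF q s(1), of 2 0] lambert_minus_has_derivative_s[OF q s(2), of 2 0]]]
  show ?thesis unfolding phiq_def[abs_def] dphiq_def by simp
qed

lemma dphiq_has_derivative:
  assumes "s \<in> strip q"
  shows "(dphiq q has_field_derivative ddphiq q s) (at s)"
proof -
  have s: "norm (q * exp s) < 1" "norm (q * exp (- s)) < 1" using assms by (auto simp: strip_def)
  from DERIV_minus[OF DERIV_diff[OF lambert_has_derivative_s[OF q s(1), of 2 1] lambert_minus_has_derivative_s[OF q s(2), of 2 1]]]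
  show ?thesis unfolding dphiq_def[abs_def] ddphiq_def by simp
qed

lemma isCont_zetaq: "s \<in> strip q \<Longrightarrow> exp s \<noteq> 1 \<Longrightarrow> isCont (zetaq q) s"
  using zetaq_has_derivative DERIV_isCont by blast

lemma isCont_phiq: "s \<in> strip q \<Longrightarrow> isCont (phiq q) s"
  using phiq_has_derivative DERIV_isCont by blast

lemma tendsto_times_zetaq_0: "((\<lambda>t. t * zetaq q t) \<longlongrightarrow> - 1) (at 0)"
proof -
  have "((\<lambda>t::complex. (exp t - 1) / t) \<longlongrightarrow> 1) (at 0)"
    using DERIV_exp[of 0] by (simp add: DERIV_def)
  then have "((\<lambda>t::complex. - inverse ((exp t - 1) / t)) \<longlongrightarrow> - inverse 1) (at 0)"
    by (intro tendsto_minus tendsto_inverse) auto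
  then have "((\<lambda>t::complex. - inverse ((exp t - 1) / t)) \<longlongrightarrow> - 1) (at 0)" by simp
  then have 1: "((\<lambda>t::complex. t / (1 - exp t)) \<longlongrightarrow> - 1) (at 0)"
  proof (rule Lim_transform_eventually)
    show "\<forall>\<^sub>F t::complex in at 0. - inverse ((exp t - 1) / t) = t / (1 - exp t)"
      by (auto simp: minus_divide_right)
  qed
  have s: "norm (q * exp 0) < 1" "norm (q * exp (- 0)) < 1" using q by auto
  have "isCont (\<lambda>t. lambert 1 0 q t) 0" "isCont (\<lambda>t. lambert 1 0 q (- t)) 0"
    by (rule DERIV_isCont[OF lambert_has_derivative_s[OF q s(1)]], simp,
        rule DERIV_isCont[OF lambert_minus_has_derivative_s[OF q s(2)]], simp)
  then have "((\<lambda>t. t / (1 - exp t) * ((1 + exp t) / 2) + t * (lambert 1 0 q t - lambert 1 0 q (- t)))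
     \<longlongrightarrow> - 1 * ((1 + exp 0) / 2) + 0 * (lambert 1 0 q 0 - lambert 1 0 q (- 0))) (at 0)"
    by (intro tendsto_intros 1 isContD) auto
  then show ?thesis
    by (simp add: zetaq_def[abs_def] algebra_simps)
qed

end

text \<open>The Fourier expansions converge only to the left of the imaginary axis, whereas the identities are needed at points on it. The
identity theorem carries them over, together with all derivatives, since they then hold in a full neighbourhood.\<close>

lemma eventually_zero_from_left_half_plane:
  assumes "Re s0 = 0" "open S" "s0 \<in> S" "f holomorphic_on S" "\<And>s. s \<in> S \<Longrightarrow> Re s < 0 \<Longrightarrow> f s = 0"
  shows "\<forall>\<^sub>F s in nhds s0. f s = 0"
proof -
  obtain r where r: "r > 0" "ball s0 r \<subseteq> S" using assms openE by blast
  have "f s = 0" if "s \<in> ball s0 r" for s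
  proof (rule analytic_continuation_open[where s = "ball s0 r \<inter> {s. Re s < 0}" and s' = "ball s0 r" and f = f and g = "\<lambda>_. 0"])
    show "open (ball s0 r \<inter> {s. Re s < 0})" by (intro open_Int open_ball open_halfspace_Re_lt)
    have "s0 - of_real (r / 2) \<in> ball s0 r \<inter> {s. Re s < 0}" using r assms(1) by (auto simp: dist_norm)
    then show "ball s0 r \<inter> {s. Re s < 0} \<noteq> {}" by blast
    show "f holomorphic_on ball s0 r" by (rule holomorphic_on_subset[OF assms(4) r(2)])
  qed (use that assms r in auto)
  then show ?thesis using r by (auto simp: eventually_nhds_metric dist_commute)
qed

lemma has_derivative_zero_of_eventually_constant:
  assumes "\<forall>\<^sub>F s in nhds a. f s = c" "(f has_field_derivative D) (at a)"
  shows "D = 0"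
proof -
  have "((\<lambda>_. c) has_field_derivative D) (at a)"
    using assms(2) DERIV_cong_ev[OF refl assms(1) refl] by blast
  then show ?thesis using DERIV_unique DERIV_const by blast
qed

context
  fixes q :: complex
  assumes q0: "q \<noteq> 0" and q: "norm q < 1"
begin

text \<open>The limit \<open>t \<rightarrow> 0\<close> of the addition formula: the factor \<open>Z(t) (Z(s) - Z(s + t))\<close> tends to \<open>Z'(s)\<close>
because \<open>Z\<close> has residue \<open>-1\<close> at 0.\<close>

lemma heat_left:
  assumes s: "s \<in> strip q" "Re s < 0"
  shows "dzetaq q s - zetaq q s ^ 2 + 2 * phiq q s + phiq q 0 = - (1 / 4)"
proof -
  let ?F = "at 0 within {t. Re t < 0} :: complex filter"
  have F: "?F \<noteq> bot"
  proof -
    have "(0::complex) islimpt {t. Re t < 0}"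
    proof (rule islimptI)
      fix T :: "complex set" assume "0 \<in> T" "open T"
      then obtain r where r: "r > 0" "ball 0 r \<subseteq> T" using openE by blast
      then show "\<exists>y\<in>{t. Re t < 0}. y \<in> T \<and> y \<noteq> 0"
        by (intro bexI[of _ "- of_real (r / 2)"]) auto
    qed
    then show ?thesis by (simp add: trivial_limit_within)
  qed
  have le: "?F \<le> at 0" by (simp add: at_le)
  have e: "exp s \<noteq> 1" using s by (metis norm_exp_eq_Re norm_one exp_eq_one_iff less_irrefl)
  have lim0: "((\<lambda>t. s + t) \<longlongrightarrow> s) ?F" by (auto intro!: tendsto_eq_intros)
  have 1: "((\<lambda>t. (zetaq q (s + t) - zetaq q s) / t) \<longlongrightarrow> dzetaq q s) ?F"
    using zetaq_has_derivative[OF q s(1) e] le by (auto simp: DERIV_def intro: tendsto_mono)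
  have 2: "((\<lambda>t. t * zetaq q t) \<longlongrightarrow> - 1) ?F" using tendsto_times_zetaq_0[OF q] le by (rule tendsto_mono[rotated])
  have 3: "((\<lambda>t. zetaq q (s + t)) \<longlongrightarrow> zetaq q s) ?F" "((\<lambda>t. phiq q (s + t)) \<longlongrightarrow> phiq q s) ?F"
    using isCont_tendsto_compose[OF isCont_zetaq[OF q s(1) e] lim0] isCont_tendsto_compose[OF isCont_phiq[OF q s(1)] lim0] by auto
  have 4: "(phiq q \<longlongrightarrow> phiq q 0) ?F"
    using isCont_phiq[OF q imaginary_in_strip[OF q, of 0]] le by (auto simp: isCont_def intro: tendsto_mono)
  have "((\<lambda>t. - (t * zetaq q t) * ((zetaq q (s + t) - zetaq q s) / t) - zetaq q s * zetaq q (s + t)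
          + phiq q s + phiq q t + phiq q (s + t))
     \<longlongrightarrow> - (- 1) * dzetaq q s - zetaq q s * zetaq q s + phiq q s + phiq q 0 + phiq q s) ?F"
    by (intro tendsto_intros 1 2 3 4)
  moreover have "\<forall>\<^sub>F t in ?F. - (t * zetaq q t) * ((zetaq q (s + t) - zetaq q s) / t) - zetaq q s * zetaq q (s + t)
          + phiq q s + phiq q t + phiq q (s + t) = - (1 / 4)"
  proof -
    have "norm q < norm (exp (s + 0))"
      using strip_norm_less[OF s(1)] by simp
    moreover have "((\<lambda>t. norm (exp (s + t))) \<longlongrightarrow> norm (exp (s + 0))) ?F"
      by (intro tendsto_intros)
    ultimately have "\<forall>\<^sub>F t in ?F. norm q < norm (exp (s + t))"
      using order_tendstoD(1) by blast
    moreover have "\<forall>\<^sub>F t in ?F. t \<in> {t. Re t < 0} \<and> t \<noteq> 0" by (auto simp: eventually_at_filter)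
    ultimately show ?thesis
    proof eventually_elim
      case (elim t)
      then have "zetaq q s * zetaq q t - (zetaq q s + zetaq q t) * zetaq q (s + t)
         + phiq q s + phiq q t + phiq q (s + t) = - (1 / 4)"
        using s by (intro zeta_addition q0 q) auto
      moreover have eq: "- (t * zetaq q t) * ((zetaq q (s + t) - zetaq q s) / t) = zetaq q t * (zetaq q s - zetaq q (s + t))"
        using elim by (simp add: field_simps)
      ultimately show ?case by (simp only: eq) (simp add: algebra_simps)
    qed
  qed
  ultimately have "((\<lambda>t. - (1 / 4)) \<longlongrightarrow> - (- 1) * dzetaq q s - zetaq q s * zetaq q s + phiq q s + phiq q 0 + phiq q s) ?F"
    by (rule Lim_transform_eventually)
  then have "- (1 / 4) = - (- 1) * dzetaq q s - zetaq q s * zetaq q s + phiq q s + phiq q 0 + phiq q s"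
    using F tendsto_unique[OF _ tendsto_const] by blast
  then show ?thesis by (simp add: algebra_simps power2_eq_square)
qed

text \<open>This is the heat equation for \<open>\<theta>\<close>: here \<open>dzetaq - zetaq^2\<close> is \<open>- \<theta>''/\<theta>\<close>, and
\<open>2 \<Phi>(s) + \<Phi>(0) + 1/4\<close> is twice the logarithmic derivative of \<open>\<theta>\<close> under \<open>q d/dq\<close>, with \<open>1/4\<close>
coming from the factor \<open>q^(1/8)\<close> of \<open>\<theta>\<close>.\<close>

lemma heat_equation:
  assumes s0: "Re s0 = 0" "exp s0 \<noteq> 1"
  shows "\<forall>\<^sub>F s in nhds s0. dzetaq q s = zetaq q s ^ 2 - 2 * phiq q s - phiq q 0 - 1 / 4"
proof -
  define S where "S = strip q \<inter> {s. exp s \<noteq> 1}"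
  have S: "open S" "s0 \<in> S"
    using s0 q imaginary_in_strip by (auto simp: S_def open_strip intro!: open_Int open_Collect_neq continuous_intros)
  have "zetaq q holomorphic_on S" "phiq q holomorphic_on S"
    using zetaq_has_derivative[OF q] phiq_has_derivative[OF q] S(1)
    by (auto simp: holomorphic_on_open S_def)
  moreover have "dzetaq q holomorphic_on S"
  proof (rule holomorphic_transform[OF holomorphic_deriv[OF \<open>zetaq q holomorphic_on S\<close> S(1)]])
    show "deriv (zetaq q) s = dzetaq q s" if "s \<in> S" for s
      using that zetaq_has_derivative[OF q] by (auto simp: S_def intro!: DERIV_imp_deriv)
  qed
  ultimately have "(\<lambda>s. dzetaq q s - zetaq q s ^ 2 + 2 * phiq q s + phiq q 0 + 1 / 4) holomorphic_on S"
    by (intro holomorphic_intros)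
  from eventually_zero_from_left_half_plane[OF s0(1) S this]
  have "\<forall>\<^sub>F s in nhds s0. dzetaq q s - zetaq q s ^ 2 + 2 * phiq q s + phiq q 0 + 1 / 4 = 0"
    using heat_left by (auto simp: S_def)
  then show ?thesis by eventually_elim (simp add: algebra_simps)
qed

text \<open>Differentiating the heat equation expresses \<open>Z''\<close> by quantities already at hand, so no further Lambert series is needed.\<close>

lemma dzetaq_has_derivative:
  assumes s0: "Re s0 = 0" "exp s0 \<noteq> 1"
  shows "\<forall>\<^sub>F s in nhds s0. (dzetaq q has_field_derivative 2 * zetaq q s * dzetaq q s - 2 * dphiq q s) (at s)"
proof -
  have "\<forall>\<^sub>F s in nhds s0. s \<in> strip q \<inter> {s. exp s \<noteq> 1}"
    using s0 q imaginary_in_strip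
    by (intro eventually_nhds_in_open) (auto simp: open_strip intro!: open_Int open_Collect_neq continuous_intros)
  moreover have "\<forall>\<^sub>F s in nhds s0. \<forall>\<^sub>F t in nhds s. dzetaq q t = zetaq q t ^ 2 - 2 * phiq q t - phiq q 0 - 1 / 4"
    using heat_equation[OF s0] by (simp add: eventually_eventually)
  ultimately show ?thesis
  proof eventually_elim
    case (elim s)
    have "((\<lambda>s. zetaq q s ^ 2 - 2 * phiq q s - phiq q 0 - 1 / 4) has_field_derivative 2 * zetaq q s * dzetaq q s - 2 * dphiq q s) (at s)"
      using elim by (auto intro!: derivative_eq_intros zetaq_has_derivative[OF q] phiq_has_derivative[OF q])
    then show ?case
      using elim(2) by (subst DERIV_cong_ev[OF refl _ refl]) auto
  qed
qed

text \<open>The diagonal \<open>t = s\<close> of the addition formula, with its first and second derivatives; \<open>Z''\<close> is written through the heat equation.\<close>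

lemma zeta_duplication:
  assumes s0: "Re s0 = 0" "exp (2 * s0) \<noteq> 1"
  shows "zetaq q s0 ^ 2 - 2 * zetaq q s0 * zetaq q (2 * s0) + 2 * phiq q s0 + phiq q (2 * s0) = - (1 / 4)" (is ?A)
    and "zetaq q s0 * dzetaq q s0 - dzetaq q s0 * zetaq q (2 * s0) - 2 * zetaq q s0 * dzetaq q (2 * s0)
          + dphiq q s0 + dphiq q (2 * s0) = 0" (is ?B)
    and "dzetaq q s0 ^ 2 + zetaq q s0 * (2 * zetaq q s0 * dzetaq q s0 - 2 * dphiq q s0)
         - (2 * zetaq q s0 * dzetaq q s0 - 2 * dphiq q s0) * zetaq q (2 * s0)
         - 4 * dzetaq q s0 * dzetaq q (2 * s0)
         - 4 * zetaq q s0 * (2 * zetaq q (2 * s0) * dzetaq q (2 * s0) - 2 * dphiq q (2 * s0))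
         + ddphiq q s0 + 2 * ddphiq q (2 * s0) = 0" (is ?C)
proof -
  have exp2: "exp (2 * s) = exp s ^ 2" for s :: complex using exp_of_nat_mult[of 2 s] by simp
  define S where "S = {s. s \<in> strip q \<and> 2 * s \<in> strip q \<and> exp (2 * s) \<noteq> 1}"
  have "open {s. 2 * s \<in> strip q}"
    using open_vimage[OF open_strip, of "\<lambda>s. 2 * s" q] by (simp add: vimage_def continuous_intros)
  then have S: "open S" "s0 \<in> S"
    using s0 q imaginary_in_strip unfolding S_def
    by (auto intro!: open_Collect_conj open_Collect_neq continuous_intros simp: open_strip)
  have SD: "s \<in> strip q" "2 * s \<in> strip q" "exp s \<noteq> 1" "exp (2 * s) \<noteq> 1" if "s \<in> S" for s
    using that by (auto simp: S_def exp2)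
  note D = zetaq_has_derivative[OF q] phiq_has_derivative[OF q] dphiq_has_derivative[OF q]
  have D2: "((\<lambda>s. f (2 * s)) has_field_derivative 2 * f' ) (at s)"
    if "(f has_field_derivative f') (at (2 * s))" for f f' s
    using DERIV_chain2[where g = "\<lambda>s. 2 * s" and x = s and s = UNIV, OF that DERIV_cmult_Id] by (simp add: mult.commute)
  have DD: "(zetaq q has_field_derivative dzetaq q s) (at s)"
    "((\<lambda>s. zetaq q (2 * s)) has_field_derivative 2 * dzetaq q (2 * s)) (at s)"
    "(phiq q has_field_derivative dphiq q s) (at s)"
    "((\<lambda>s. phiq q (2 * s)) has_field_derivative 2 * dphiq q (2 * s)) (at s)"
    "(dphiq q has_field_derivative ddphiq q s) (at s)"
    "((\<lambda>s. dphiq q (2 * s)) has_field_derivative 2 * ddphiq q (2 * s)) (at s)" if "s \<in> S" for s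
    using SD[OF that] by (auto intro!: D D2)
  \<comment> \<open>\<open>J\<close> is the defect of the duplication formula and \<open>J'\<close> half of its derivative.\<close>
  define J where "J = (\<lambda>s. zetaq q s ^ 2 - 2 * zetaq q s * zetaq q (2 * s) + 2 * phiq q s + phiq q (2 * s) + 1 / 4)"
  define J' where "J' = (\<lambda>s. zetaq q s * dzetaq q s - dzetaq q s * zetaq q (2 * s) - 2 * zetaq q s * dzetaq q (2 * s)
          + dphiq q s + dphiq q (2 * s))"
  have dJ: "(J has_field_derivative 2 * J' s) (at s)" if "s \<in> S" for s
    unfolding J_def J'_def
    by (rule DERIV_cong, (rule derivative_intros DD[OF that])+, simp add: algebra_simps)
  have Jz: "\<forall>\<^sub>F s in nhds s0. J s = 0"
  proof (rule eventually_zero_from_left_half_plane[OF s0(1) S])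
    show "J holomorphic_on S" using dJ S(1) by (auto simp: holomorphic_on_open)
    show "J s = 0" if "s \<in> S" "Re s < 0" for s
    proof -
      have "norm q < norm (exp (s + s))"
        using SD(2)[OF that(1)] strip_norm_less[of "2 * s" q] by (simp only: mult_2)
      from zeta_addition[OF q0 q that(2) that(2) this, folded mult_2] show ?thesis
        by (simp add: J_def algebra_simps power2_eq_square)
    qed
  qed
  then have "J s0 = 0" by (rule eventually_nhds_x_imp_x)
  then show ?A by (simp add: J_def algebra_simps)
  have "\<forall>\<^sub>F s in nhds s0. s \<in> S" using S by (rule eventually_nhds_in_open)
  moreover have "\<forall>\<^sub>F s in nhds s0. \<forall>\<^sub>F t in nhds s. J t = 0" using Jz by (simp add: eventually_eventually)
  ultimately have J'z: "\<forall>\<^sub>F s in nhds s0. J' s = 0"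
  proof eventually_elim
    case (elim s)
    show ?case using has_derivative_zero_of_eventually_constant[OF elim(2) dJ[OF elim(1)]] by simp
  qed
  then have "J' s0 = 0" by (rule eventually_nhds_x_imp_x)
  then show ?B by (simp add: J'_def)
  have e: "exp s0 \<noteq> 1" using s0 by (auto simp: exp2)
  have E: "(dzetaq q has_field_derivative 2 * zetaq q s0 * dzetaq q s0 - 2 * dphiq q s0) (at s0)"
    "(dzetaq q has_field_derivative 2 * zetaq q (2 * s0) * dzetaq q (2 * s0) - 2 * dphiq q (2 * s0)) (at (2 * s0))"
    using eventually_nhds_x_imp_x[OF dzetaq_has_derivative[of s0]] eventually_nhds_x_imp_x[OF dzetaq_has_derivative[of "2 * s0"]]
      s0 e by auto
  have "(J' has_field_derivative (dzetaq q s0 ^ 2 + zetaq q s0 * (2 * zetaq q s0 * dzetaq q s0 - 2 * dphiq q s0)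
         - (2 * zetaq q s0 * dzetaq q s0 - 2 * dphiq q s0) * zetaq q (2 * s0)
         - 4 * dzetaq q s0 * dzetaq q (2 * s0)
         - 4 * zetaq q s0 * (2 * zetaq q (2 * s0) * dzetaq q (2 * s0) - 2 * dphiq q (2 * s0))
         + ddphiq q s0 + 2 * ddphiq q (2 * s0))) (at s0)"
    unfolding J'_def
    by (rule DERIV_cong, (rule derivative_intros DD[OF S(2)] E(1) D2[OF E(2)])+, simp add: algebra_simps power2_eq_square)
  from has_derivative_zero_of_eventually_constant[OF J'z this] show ?C .
qed

end

section \<open>Weight one Eisenstein series at the points of order five\<close>

definition tors1 :: complex where "tors1 = of_real (2 * pi / 5) * \<i>"
definition tors2 :: complex where "tors2 = of_real (4 * pi / 5) * \<i>"

lemma Re_tors [simp]: "Re tors1 = 0" "Re tors2 = 0"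
  by (simp_all add: tors1_def tors2_def)

lemma two_tors: "2 * tors1 = tors2" "2 * tors2 = 2 * of_real pi * \<i> - tors1"
  by (simp_all add: tors1_def tors2_def algebra_simps)

lemma exp_imaginary: "exp (of_real t * \<i>) = of_real (cos t) + \<i> * of_real (sin t)"
  by (metis cis_conv_exp cis.code complex_eq_iff Complex_eq mult.commute)

lemma cos_fifth: "cos (2 * pi / 5) = (sqrt 5 - 1) / 4" "cos (4 * pi / 5) = - (sqrt 5 + 1) / 4"
proof -
  define c where "c = cos (2 * pi / 5)"
  have c4: "cos (4 * pi / 5) = 2 * c ^ 2 - 1"
    using cos_double_cos[of "2 * pi / 5"] by (simp add: c_def)
  have "3 * (2 * pi / 5) = 2 * pi - 4 * pi / 5" by simp
  then have "cos (3 * (2 * pi / 5)) = cos (2 * pi - 4 * pi / 5)" by (simp only:)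
  also have "\<dots> = cos (4 * pi / 5)" by (subst cos_diff) simp
  also have "\<dots> = 2 * c ^ 2 - 1" by (rule c4)
  finally have "4 * c ^ 3 - 3 * c = 2 * c ^ 2 - 1" by (simp only: cos_treble_cos flip: c_def)
  then have "(c - 1) * (4 * c ^ 2 + 2 * c - 1) = 0" by algebra
  moreover have "c < 1"
    using cos_monotone_0_pi[of 0 "2 * pi / 5"] by (simp add: c_def)
  ultimately have "4 * c ^ 2 + 2 * c - 1 = 0" by auto
  then have "(4 * c + 1) ^ 2 = (sqrt 5) ^ 2" by (simp add: power2_eq_square algebra_simps)
  moreover have "c > 0" unfolding c_def by (rule cos_gt_zero) (auto simp: field_simps)
  ultimately have "4 * c + 1 = sqrt 5" by (elim power2_eq_imp_eq) auto
  then have c: "c = (sqrt 5 - 1) / 4" by simp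
  then show "cos (2 * pi / 5) = (sqrt 5 - 1) / 4" by (simp only: c_def)
  have "2 * ((r - 1) / 4) ^ 2 - 1 = - (r + 1) / 4" if "r ^ 2 = 5" for r :: real
    using that by (simp add: power2_eq_square field_simps)
  then show "cos (4 * pi / 5) = - (sqrt 5 + 1) / 4" by (simp only: c4 c) simp
qed

lemma exp_tors_neq_1: "exp tors1 \<noteq> 1" "exp tors2 \<noteq> 1"
proof -
  have "exp tors1 = 1 \<Longrightarrow> cos (2 * pi / 5) = 1" "exp tors2 = 1 \<Longrightarrow> cos (4 * pi / 5) = 1"
    unfolding tors1_def tors2_def exp_imaginary by (simp_all add: complex_eq_iff)
  moreover have "sqrt 5 \<noteq> 5" "sqrt 5 \<noteq> (-5 :: real)"
  proof -
    show "sqrt 5 \<noteq> 5" using real_sqrt_less_iff[of 5 25] by auto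
    have "sqrt 5 \<ge> (0::real)" by simp
    then show "sqrt 5 \<noteq> (-5 :: real)" by linarith
  qed
  ultimately show "exp tors1 \<noteq> 1" "exp tors2 \<noteq> 1" unfolding cos_fifth by (auto simp: field_simps)
qed

lemma exp_plus_exp_minus_tors:
  "exp tors1 + exp (- tors1) = of_real ((sqrt 5 - 1) / 2)"
  "exp tors2 + exp (- tors2) = of_real (- (sqrt 5 + 1) / 2)"
proof -
  have *: "exp (of_real t * \<i>) + exp (- (of_real t * \<i>)) = of_real (2 * cos t)" for t
    using exp_imaginary[of t] exp_imaginary[of "- t"] by simp
  show "exp tors1 + exp (- tors1) = of_real ((sqrt 5 - 1) / 2)"
    "exp tors2 + exp (- tors2) = of_real (- (sqrt 5 + 1) / 2)"
    unfolding tors1_def tors2_def * cos_fifth by simp_all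
qed

text \<open>Doubling \<open>tors2\<close> leads to \<open>2 \<pi> \<i> - tors1\<close>; periodicity and parity bring it back to \<open>tors1\<close>.\<close>

lemma lambert_reflect: "lambert j k q (2 * of_real pi * \<i> - s) = lambert j k q (- s)"
  "lambert j k q (- (2 * of_real pi * \<i> - s)) = lambert j k q s"
proof -
  have "exp (of_nat n * (2 * of_real pi * \<i> - s)) = exp (of_nat n * - s)" for n
    using exp_of_nat_mult[of n "2 * of_real pi * \<i> - s"] exp_of_nat_mult[of n "- s"]
    by (simp add: exp_diff exp_minus divide_inverse)
  then show "lambert j k q (2 * of_real pi * \<i> - s) = lambert j k q (- s)" by (simp only: lambert_def)
  have "exp (of_nat n * - (2 * of_real pi * \<i> - s)) = exp (of_nat n * s)" for n
    using exp_of_nat_mult[of n "- (2 * of_real pi * \<i> - s)"] exp_of_nat_mult[of n "s"]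
    by (simp add: exp_diff exp_minus divide_inverse)
  then show "lambert j k q (- (2 * of_real pi * \<i> - s)) = lambert j k q s" by (simp only: lambert_def)
qed

lemma zetaq_phiq_reflect:
  "zetaq q (2 * of_real pi * \<i> - s) = - zetaq q s"
  "phiq q (2 * of_real pi * \<i> - s) = phiq q s"
  "dzetaq q (2 * of_real pi * \<i> - s) = dzetaq q s"
  "dphiq q (2 * of_real pi * \<i> - s) = - dphiq q s"
  "ddphiq q (2 * of_real pi * \<i> - s) = ddphiq q s"
proof -
  have e: "exp (2 * of_real pi * \<i> - s) = 1 / exp s" by (simp add: exp_diff)
  have u: "(1 + 1 / u) / (2 * (1 - 1 / u)) = - ((1 + u) / (2 * (1 - u)))" 
          "1 / u / (1 - 1 / u) ^ 2 = u / (1 - u) ^ 2" if "u \<noteq> 0" for u :: complex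
  proof -
    show "(1 + 1 / u) / (2 * (1 - 1 / u)) = - ((1 + u) / (2 * (1 - u)))"
      using that by (cases "u = 1") (auto simp: divide_simps, algebra)
    show "1 / u / (1 - 1 / u) ^ 2 = u / (1 - u) ^ 2"
      using that by (cases "u = 1") (auto simp: divide_simps power2_eq_square, algebra)
  qed
  show "zetaq q (2 * of_real pi * \<i> - s) = - zetaq q s"
    unfolding zetaq_def lambert_reflect e u(1)[OF exp_not_eq_zero] by simp
  show "dzetaq q (2 * of_real pi * \<i> - s) = dzetaq q s"
    unfolding dzetaq_def lambert_reflect e u(2)[OF exp_not_eq_zero] by simp
qed (unfold phiq_def dphiq_def ddphiq_def lambert_reflect, simp_all)

definition eisX :: "complex \<Rightarrow> complex" where "eisX q = zetaq q tors1"
definition eisY :: "complex \<Rightarrow> complex" where "eisY q = zetaq q tors2"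

text \<open>By the heat equation this is \<open>phiq q 0 + 1/12\<close> for \<open>q \<noteq> 0\<close>, which is \<open>E\<^sub>2/12\<close>. Defining it
through \<open>dzetaq\<close> makes its derivative in \<open>q\<close> available.\<close>

definition eisE :: "complex \<Rightarrow> complex" where
  "eisE q = (7 * eisX q ^ 2 - 12 * eisX q * eisY q - 2 * eisY q ^ 2) / 3 - dzetaq q tors1"

text \<open>At the two points of order five the duplication formula and its derivatives give two linear equations for each of the pairs of
values of \<open>\<Phi>\<close>, \<open>\<Phi>'\<close> and \<open>\<Phi>''\<close>, with an invertible constant matrix. Solving them makes these values
polynomials in \<open>x, y, e\<close>, homogeneous of weight 2, 3 and 4 respectively, apart from the shift by \<open>1/12\<close>.\<close>

lemma
  assumes q: "q \<noteq> 0" "norm q < 1"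
  defines "x \<equiv> eisX q" and "y \<equiv> eisY q" and "e \<equiv> eisE q"
  shows phiq_0: "phiq q 0 = e - 1 / 12"
    and phiq_tors: "phiq q tors1 = (6 * x * y - 2 * x ^ 2 + y ^ 2) / 3 - 1 / 12"
      "phiq q tors2 = (- 6 * x * y - 2 * y ^ 2 + x ^ 2) / 3 - 1 / 12"
    and dphiq_tors: "dphiq q tors1 = (- 13 * x ^ 3 + 39 * x ^ 2 * y + 47 * x * y ^ 2 + 9 * y ^ 3) / 6 - x * e"
      "dphiq q tors2 = (- 9 * x ^ 3 + 47 * x ^ 2 * y - 39 * x * y ^ 2 - 13 * y ^ 3) / 6 - y * e"
    and ddphiq_tors: "ddphiq q tors1 = (- 32 * x ^ 4 + 102 * x ^ 3 * y + 80 * x ^ 2 * y ^ 2 - 78 * x * y ^ 3 - 23 * y ^ 4) / 9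
         + (- 14 * x ^ 2 + 24 * x * y + 4 * y ^ 2) / 3 * e + e ^ 2"
proof -
  define x' y' f1 f2 g1 g2 where defs: "x' = dzetaq q tors1" "y' = dzetaq q tors2" "f1 = dphiq q tors1" "f2 = dphiq q tors2"
    "g1 = ddphiq q tors1" "g2 = ddphiq q tors2"
  have e2: "exp (2 * tors1) \<noteq> 1" "exp (2 * tors2) \<noteq> 1"
    using exp_tors_neq_1 unfolding two_tors by (auto simp: exp_diff)
  note D1 = zeta_duplication[OF q Re_tors(1) e2(1), unfolded two_tors zetaq_phiq_reflect]
  note D2 = zeta_duplication[OF q Re_tors(2) e2(2), unfolded two_tors zetaq_phiq_reflect]
  note D1 = D1[folded eisX_def eisY_def, folded x_def y_def, folded defs]
  note D2 = D2[folded eisX_def eisY_def, folded x_def y_def, folded defs]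
  have 3: "3 * phiq q tors1 = (6 * x * y - 2 * x ^ 2 + y ^ 2) - 1 / 4"
     "3 * phiq q tors2 = (- 6 * x * y - 2 * y ^ 2 + x ^ 2) - 1 / 4"
    using D1(1) D2(1) by (simp_all add: field_simps) (algebra+)
  then show p: "phiq q tors1 = (6 * x * y - 2 * x ^ 2 + y ^ 2) / 3 - 1 / 12"
    "phiq q tors2 = (- 6 * x * y - 2 * y ^ 2 + x ^ 2) / 3 - 1 / 12"
    by algebra+
  have H: "dzetaq q s = zetaq q s ^ 2 - 2 * phiq q s - phiq q 0 - 1 / 4" if "s \<in> {tors1, tors2}" for s
    using eventually_nhds_x_imp_x[OF heat_equation[OF q, of s]] that exp_tors_neq_1 by auto
  have "x' = x ^ 2 - 2 * phiq q tors1 - phiq q 0 - 1 / 4" "y' = y ^ 2 - 2 * phiq q tors2 - phiq q 0 - 1 / 4"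
    using H by (auto simp: defs x_def y_def eisX_def eisY_def)
  note H = this
  have ex: "e = (7 * x ^ 2 - 12 * x * y - 2 * y ^ 2) / 3 - x'"
    by (simp add: e_def eisE_def x_def y_def defs)
  show ph0: "phiq q 0 = e - 1 / 12" using H(1) unfolding ex p by algebra
  have x': "x' = (7 * x ^ 2 - 12 * x * y - 2 * y ^ 2) / 3 - e" using ex by simp
  have y': "y' = (- 2 * x ^ 2 + 12 * x * y + 7 * y ^ 2) / 3 - e" using H(2) unfolding p ph0 by algebra
  have "2 * f1 = (y * y' + x * y' - 2 * y * x') - (x * x' - x' * y - 2 * x * y')"
    "2 * f2 = - ((y * y' + x * y' - 2 * y * x') + (x * x' - x' * y - 2 * x * y'))"
    using D1(2) D2(2) by algebra+
  then have f: "f1 = (- 13 * x ^ 3 + 39 * x ^ 2 * y + 47 * x * y ^ 2 + 9 * y ^ 3) / 6 - x * e"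
      "f2 = (- 9 * x ^ 3 + 47 * x ^ 2 * y - 39 * x * y ^ 2 - 13 * y ^ 3) / 6 - y * e"
    unfolding x' y' by algebra+
  then show "dphiq q tors1 = (- 13 * x ^ 3 + 39 * x ^ 2 * y + 47 * x * y ^ 2 + 9 * y ^ 3) / 6 - x * e"
      "dphiq q tors2 = (- 9 * x ^ 3 + 47 * x ^ 2 * y - 39 * x * y ^ 2 - 13 * y ^ 3) / 6 - y * e"
    by (simp_all add: defs)
  define x2 y2 where "x2 = 2 * x * x' - 2 * f1" and "y2 = 2 * y * y' - 2 * f2"
  have x2: "x2 = 9 * x ^ 3 - 21 * x ^ 2 * y - 17 * x * y ^ 2 - 3 * y ^ 3"
    and y2: "y2 = 3 * x ^ 3 - 17 * x ^ 2 * y + 21 * x * y ^ 2 + 9 * y ^ 3"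
    unfolding x2_def y2_def f x' y' by algebra+
  have "x' ^ 2 + x * x2 - x2 * y - 4 * x' * y' - 4 * x * y2 + g1 + 2 * g2 = 0"
    using D1(3) by (simp add: x2_def y2_def)
  moreover have "y' ^ 2 + y * y2 + y2 * x - 4 * x' * y' + 4 * y * x2 + g2 + 2 * g1 = 0"
    using D2(3) by (simp add: x2_def y2_def algebra_simps)
  ultimately have "3 * g1 = (x' ^ 2 + x * x2 - x2 * y - 4 * x' * y' - 4 * x * y2) - 2 * (y' ^ 2 + y * y2 + y2 * x - 4 * x' * y' + 4 * y * x2)"
    by algebra
  then have "g1 = (- 32 * x ^ 4 + 102 * x ^ 3 * y + 80 * x ^ 2 * y ^ 2 - 78 * x * y ^ 3 - 23 * y ^ 4) / 9
         + (- 14 * x ^ 2 + 24 * x * y + 4 * y ^ 2) / 3 * e + e ^ 2"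
    unfolding x2 y2 unfolding x' y' by algebra
  then show "ddphiq q tors1 = (- 32 * x ^ 4 + 102 * x ^ 3 * y + 80 * x ^ 2 * y ^ 2 - 78 * x * y ^ 3 - 23 * y ^ 4) / 9
         + (- 14 * x ^ 2 + 24 * x * y + 4 * y ^ 2) / 3 * e + e ^ 2"
    by (simp add: defs)
qed

lemma zetaq_has_derivative_q:
  assumes "norm q < 1" "Re s = 0"
  shows "((\<lambda>q. zetaq q s) has_field_derivative dlambert 0 q s - dlambert 0 q (- s)) (at q)"
    and "q * (dlambert 0 q s - dlambert 0 q (- s)) = - dphiq q s"
proof -
  show "((\<lambda>q. zetaq q s) has_field_derivative dlambert 0 q s - dlambert 0 q (- s)) (at q)"
    unfolding zetaq_def
    using DERIV_diff[OF DERIV_add[OF DERIV_const lambert_has_derivative_q[OF assms, of 0]]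
        lambert_has_derivative_q[OF assms(1), of "- s" 0]] assms(2) by simp
  show "q * (dlambert 0 q s - dlambert 0 q (- s)) = - dphiq q s"
    using times_dlambert[OF assms(1), of s 0] times_dlambert[OF assms(1), of "- s" 0] assms(2)
    by (simp add: dphiq_def algebra_simps)
qed

lemma dzetaq_has_derivative_q:
  assumes "norm q < 1" "Re s = 0"
  shows "((\<lambda>q. dzetaq q s) has_field_derivative dlambert 1 q s + dlambert 1 q (- s)) (at q)"
    and "q * (dlambert 1 q s + dlambert 1 q (- s)) = - ddphiq q s"
proof -
  show "((\<lambda>q. dzetaq q s) has_field_derivative dlambert 1 q s + dlambert 1 q (- s)) (at q)"
    unfolding dzetaq_def
    using DERIV_add[OF DERIV_add[OF DERIV_const lambert_has_derivative_q[OF assms, of 1]]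
        lambert_has_derivative_q[OF assms(1), of "- s" 1]] assms(2) by simp
  show "q * (dlambert 1 q s + dlambert 1 q (- s)) = - ddphiq q s"
    using times_dlambert[OF assms(1), of s 1] times_dlambert[OF assms(1), of "- s" 1] assms(2)
    by (simp add: ddphiq_def algebra_simps)
qed

lemma eis_holomorphic: "eisX holomorphic_on ball 0 1" "eisY holomorphic_on ball 0 1" "eisE holomorphic_on ball 0 1"
proof -
  show 1: "eisX holomorphic_on ball 0 1" "eisY holomorphic_on ball 0 1"
    unfolding eisX_def eisY_def using zetaq_has_derivative_q(1)[of _ tors1] zetaq_has_derivative_q(1)[of _ tors2] 
    by (auto simp: holomorphic_on_open) blast+
  have "(\<lambda>q. dzetaq q tors1) holomorphic_on ball 0 1"
    using dzetaq_has_derivative_q(1)[of _ tors1] by (auto simp: holomorphic_on_open) blast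
  then show "eisE holomorphic_on ball 0 1"
    unfolding eisE_def using 1 by (intro holomorphic_intros) auto
qed

text \<open>Closure of the ring generated by \<open>x, y, e\<close> under \<open>q d/dq\<close>, the level five analogue of Ramanujan's system for
\<open>E\<^sub>2, E\<^sub>4, E\<^sub>6\<close>.\<close>

lemma eis_has_derivative:
  assumes q: "q \<noteq> 0" "norm q < 1"
  defines "x \<equiv> eisX q" and "y \<equiv> eisY q" and "e \<equiv> eisE q"
  shows "(eisX has_field_derivative ((13 * x ^ 3 - 39 * x ^ 2 * y - 47 * x * y ^ 2 - 9 * y ^ 3) / 6 + x * e) / q) (at q)"
    and "(eisY has_field_derivative ((9 * x ^ 3 - 47 * x ^ 2 * y + 39 * x * y ^ 2 + 13 * y ^ 3) / 6 + y * e) / q) (at q)"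
    and "(eisE has_field_derivative ((5 * x ^ 4 + 15 * x ^ 3 * y - 155 * x ^ 2 * y ^ 2 - 15 * x * y ^ 3 + 5 * y ^ 4) / 9 + e ^ 2) / q) (at q)"
proof -
  have div: "d = a / q" if "q * d = a" for a d using that q by auto
  note dphi = dphiq_tors[OF q, folded x_def y_def e_def]
  note ddphi = ddphiq_tors[OF q, folded x_def y_def e_def]
  have X: "(eisX has_field_derivative ((13 * x ^ 3 - 39 * x ^ 2 * y - 47 * x * y ^ 2 - 9 * y ^ 3) / 6 + x * e) / q) (at q)"
    unfolding eisX_def
    by (rule DERIV_cong[OF zetaq_has_derivative_q(1)[OF q(2) Re_tors(1)] div])
       (simp add: zetaq_has_derivative_q(2)[OF q(2) Re_tors(1)] dphi field_simps)
  have Y: "(eisY has_field_derivative ((9 * x ^ 3 - 47 * x ^ 2 * y + 39 * x * y ^ 2 + 13 * y ^ 3) / 6 + y * e) / q) (at q)"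
    unfolding eisY_def
    by (rule DERIV_cong[OF zetaq_has_derivative_q(1)[OF q(2) Re_tors(2)] div])
       (simp add: zetaq_has_derivative_q(2)[OF q(2) Re_tors(2)] dphi field_simps)
  show "(eisX has_field_derivative ((13 * x ^ 3 - 39 * x ^ 2 * y - 47 * x * y ^ 2 - 9 * y ^ 3) / 6 + x * e) / q) (at q)"
    by (rule X)
  show "(eisY has_field_derivative ((9 * x ^ 3 - 47 * x ^ 2 * y + 39 * x * y ^ 2 + 13 * y ^ 3) / 6 + y * e) / q) (at q)"
    by (rule Y)
  have Z: "((\<lambda>q. dzetaq q tors1) has_field_derivative (- ddphiq q tors1) / q) (at q)"
    by (rule DERIV_cong[OF dzetaq_has_derivative_q(1)[OF q(2) Re_tors(1)] div])
       (rule dzetaq_has_derivative_q(2)[OF q(2) Re_tors(1)])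
  show "(eisE has_field_derivative ((5 * x ^ 4 + 15 * x ^ 3 * y - 155 * x ^ 2 * y ^ 2 - 15 * x * y ^ 3 + 5 * y ^ 4) / 9 + e ^ 2) / q) (at q)"
    unfolding eisE_def[abs_def]
    apply (rule DERIV_cong)
     apply (rule derivative_eq_intros X Y Z refl | simp)+
    unfolding ddphi using q
    apply (simp add: field_simps flip: x_def y_def)
    apply (simp add: algebra_simps power2_eq_square power3_eq_cube power4_eq_xxxx)
    done
qed

section \<open>The products as logarithmic derivatives\<close>

text \<open>Replacing \<open>s\<close> by \<open>s + Ln q\<close> multiplies the \<open>n\<close>-th term of the series by \<open>q^n\<close> and so cancels the
denominator \<open>1 - q^n\<close> in the difference, which is the logarithmic series of \<open>1 - q exp s\<close>. Iteration peels off one factor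
of the product at a time, and the remaining series tends to 0.\<close>

lemma qpochhammer_tendsto_exp_lambert:
  assumes q: "norm q < 1" and s: "Re s = 0"
  shows "(\<lambda>N. \<Prod>n<N. 1 - exp s * q ^ Suc n) \<longlonglongrightarrow> exp (- lambert 1 (- 1) q s)"
proof (cases "q = 0")
  case True
  then show ?thesis by simp
next
  case False
  \<comment> \<open>\<open>exp (r N)\<close> is \<open>exp s q^N\<close>, the argument left after \<open>N\<close> factors have been split off.\<close>
  define r where "r = (\<lambda>N::nat. s + of_nat N * Ln q)"
  have r: "exp (r N) = exp s * q ^ N" for N
    using False by (simp add: r_def exp_add exp_of_nat_mult exp_Ln)
  have rn: "exp (of_nat n * r N) = exp s ^ n * (q ^ n) ^ N" for n N
    by (simp add: exp_of_nat_mult r power_mult_distrib power_mult[symmetric] mult.commute)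
  have qN: "norm q ^ N \<le> 1" for N using q by (simp add: power_le_one)
  have dom: "norm (q * exp (r N)) < 1" for N
  proof -
    have "norm (q * exp (r N)) = norm q * norm q ^ N" by (simp add: r norm_mult norm_power s del: norm_exp_eq_Re) (simp add: s)
    also have "\<dots> \<le> norm q * 1" by (intro mult_left_mono qN) auto
    finally show ?thesis using q by simp
  qed
  have step: "exp (- lambert 1 (- 1) q (r N)) = (1 - exp s * q ^ Suc N) * exp (- lambert 1 (- 1) q (r (Suc N)))" for N
  proof -
    define z where "z = exp s * q ^ Suc N"
    have z: "norm z < 1" using dom[of N] by (simp add: z_def r mult_ac)
    have "(\<lambda>n. of_nat n powi (- 1) * exp (of_nat n * r N) * (q ^ n / (1 - q ^ n) ^ 1)
             - of_nat n powi (- 1) * exp (of_nat n * r (Suc N)) * (q ^ n / (1 - q ^ n) ^ 1)) sums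
          (lambert 1 (- 1) q (r N) - lambert 1 (- 1) q (r (Suc N)))"
      unfolding lambert_def by (intro sums_diff summable_sums summable_lambert q dom) auto
    moreover have "of_nat n powi (- 1) * exp (of_nat n * r N) * (q ^ n / (1 - q ^ n) ^ 1)
             - of_nat n powi (- 1) * exp (of_nat n * r (Suc N)) * (q ^ n / (1 - q ^ n) ^ 1) = z ^ n / of_nat n" for n
    proof (cases "n = 0")
      case False
      have ne: "1 - q ^ n \<noteq> 0" using power_neq_1_of_norm_less_1[OF q, of n] False by simp
      have zn: "z ^ n = exp s ^ n * (q ^ n) ^ N * q ^ n"
        by (simp add: z_def power_mult_distrib power_mult[symmetric] mult.commute power_add)
      have "of_nat n powi (- 1) * exp (of_nat n * r N) * (q ^ n / (1 - q ^ n) ^ 1)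
             - of_nat n powi (- 1) * exp (of_nat n * r (Suc N)) * (q ^ n / (1 - q ^ n) ^ 1)
            = inverse (of_nat n) * (exp s ^ n * (q ^ n) ^ N * q ^ n) * ((1 - q ^ n) / (1 - q ^ n))"
      proof -
        have "i * X * (a / (1 - a) ^ 1) - i * (X * a) * (a / (1 - a) ^ 1) = i * (X * a) * ((1 - a) / (1 - a))" 
          if "1 - a \<noteq> 0" for i X a :: complex
          using that by (simp add: divide_simps) (simp add: algebra_simps)
        from this[OF ne, of "inverse (of_nat n)" "exp s ^ n * (q ^ n) ^ N"]
        show ?thesis unfolding rn by (simp only: power_int_minus power_int_1_right power_Suc2 mult.assoc)
      qed
      also have "\<dots> = z ^ n / of_nat n" using ne by (simp add: zn divide_inverse mult.commute)
      finally show ?thesis .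
    qed auto
    ultimately have A: "(\<lambda>n. z ^ n / of_nat n) sums (lambert 1 (- 1) q (r N) - lambert 1 (- 1) q (r (Suc N)))" by simp
    have B: "(\<lambda>n. - (z ^ n / of_nat n)) sums Ln (1 - z)"
      using Ln_series'[of "- z"] z by simp
    have "lambert 1 (- 1) q (r N) - lambert 1 (- 1) q (r (Suc N)) = - Ln (1 - z)"
      using sums_unique2[OF sums_minus[OF A] B] by (metis minus_minus)
    then have "- lambert 1 (- 1) q (r N) = Ln (1 - z) + - lambert 1 (- 1) q (r (Suc N))" by (simp add: algebra_simps)
    moreover have "1 - z \<noteq> 0" using z by auto
    ultimately show ?thesis by (simp add: exp_add exp_diff exp_minus divide_inverse z_def)
  qed
  have prod: "(\<Prod>n<N. 1 - exp s * q ^ Suc n) = exp (- lambert 1 (- 1) q s) / exp (- lambert 1 (- 1) q (r N))" for N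
  proof (induction N)
    case 0
    then show ?case by (simp add: r_def)
  next
    case (Suc N)
    have "(\<Prod>n<Suc N. 1 - exp s * q ^ Suc n) = exp (- lambert 1 (- 1) q s) / exp (- lambert 1 (- 1) q (r N)) * (1 - exp s * q ^ Suc N)"
      using Suc by simp
    also have "\<dots> = exp (- lambert 1 (- 1) q s) / exp (- lambert 1 (- 1) q (r (Suc N)))"
    proof -
      have "1 - exp s * q ^ Suc N \<noteq> 0" using dom[of N] by (auto simp: r mult_ac)
      then show ?thesis unfolding step[of N] by (simp add: divide_simps)
    qed
    finally show ?case .
  qed
  have "(\<lambda>N. lambert 1 (- 1) q (r N)) \<longlonglongrightarrow> 0"
  proof (rule Lim_null_comparison)
    define M where "M = (\<Sum>n. norm (of_nat n powi (- 1) * exp (of_nat n * s) * (q ^ n / (1 - q ^ n) ^ 1)))"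
    have sm: "summable (\<lambda>n. norm (of_nat n powi (- 1) * exp (of_nat n * s) * (q ^ n / (1 - q ^ n) ^ 1)))"
      using q s by (intro summable_norm_lambert) (auto simp: norm_mult)
    have "norm (lambert 1 (- 1) q (r N)) \<le> norm q ^ N * M" for N
    proof -
      have "norm (lambert 1 (- 1) q (r N)) \<le> (\<Sum>n. norm (of_nat n powi (- 1) * exp (of_nat n * r N) * (q ^ n / (1 - q ^ n) ^ 1)))"
        unfolding lambert_def by (intro summable_norm summable_norm_lambert q dom) auto
      also have "\<dots> \<le> (\<Sum>n. norm q ^ N * norm (of_nat n powi (- 1) * exp (of_nat n * s) * (q ^ n / (1 - q ^ n) ^ 1)))"
      proof (intro suminf_le summable_norm_lambert q dom summable_mult sm)
        show "norm (of_nat n powi (- 1) * exp (of_nat n * r N) * (q ^ n / (1 - q ^ n) ^ 1))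
            \<le> norm q ^ N * norm (of_nat n powi (- 1) * exp (of_nat n * s) * (q ^ n / (1 - q ^ n) ^ 1))" for n
        proof (cases "n = 0")
          case False
          have "norm (exp (of_nat n * r N)) = norm (exp (of_nat n * s)) * (norm q ^ n) ^ N"
            unfolding rn by (simp add: exp_of_nat_mult norm_mult norm_power)
          also have "(norm q ^ n) ^ N \<le> norm q ^ N"
          proof (rule power_mono)
            show "norm q ^ n \<le> norm q"
              using False q by (metis norm_ge_zero power_decreasing power_one_right less_eq_real_def Suc_leI One_nat_def gr0I)
          qed auto
          finally have "norm (exp (of_nat n * r N)) \<le> norm (exp (of_nat n * s)) * norm q ^ N"
            by (simp add: mult_left_mono)
          then have "norm (of_nat n powi (- 1) :: complex) * norm (exp (of_nat n * r N)) * norm (q ^ n / (1 - q ^ n) ^ 1)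
              \<le> norm (of_nat n powi (- 1) :: complex) * (norm (exp (of_nat n * s)) * norm q ^ N) * norm (q ^ n / (1 - q ^ n) ^ 1)"
            by (intro mult_right_mono mult_left_mono) auto
          then show ?thesis unfolding norm_mult by (simp only: mult_ac)
        qed auto
      qed (use q s in \<open>auto simp: norm_mult\<close>)
      also have "\<dots> = norm q ^ N * M" unfolding M_def by (intro suminf_mult sm)
      finally show ?thesis .
    qed
    then show "\<forall>\<^sub>F N in sequentially. norm (lambert 1 (- 1) q (r N)) \<le> norm q ^ N * M" by simp
    have "(\<lambda>N. norm q ^ N * M) \<longlonglongrightarrow> 0 * M" using q by (intro tendsto_mult LIMSEQ_power_zero tendsto_const) auto
    then show "(\<lambda>N. norm q ^ N * M) \<longlonglongrightarrow> 0" by simp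
  qed
  then have "(\<lambda>N. exp (- lambert 1 (- 1) q s) / exp (- lambert 1 (- 1) q (r N))) \<longlonglongrightarrow> exp (- lambert 1 (- 1) q s) / exp (- 0)"
    by (intro tendsto_intros) auto
  then show ?thesis unfolding prod by simp
qed

text \<open>A logarithm of \<open>\<Prod>n\<ge>1. (1 - exp s q^n) (1 - exp (-s) q^n)\<close> that is holomorphic in \<open>q\<close> on the whole unit disc.\<close>

definition thetalog :: "complex \<Rightarrow> complex \<Rightarrow> complex" where
  "thetalog q s = - (lambert 1 (- 1) q s + lambert 1 (- 1) q (- s))"

definition dthetalog :: "complex \<Rightarrow> complex \<Rightarrow> complex" where
  "dthetalog q s = - (dlambert (- 1) q s + dlambert (- 1) q (- s))"

lemma theta_product_tendsto:
  assumes q: "norm q < 1" and s: "Re s = 0"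
  shows "(\<lambda>N. \<Prod>n<N. 1 - (exp s + exp (- s)) * q ^ Suc n + q ^ (2 * Suc n)) \<longlonglongrightarrow> exp (thetalog q s)"
proof -
  have "(\<lambda>N. (\<Prod>n<N. 1 - exp s * q ^ Suc n) * (\<Prod>n<N. 1 - exp (- s) * q ^ Suc n))
     \<longlonglongrightarrow> exp (- lambert 1 (- 1) q s) * exp (- lambert 1 (- 1) q (- s))"
    by (intro tendsto_mult qpochhammer_tendsto_exp_lambert q) (use s in auto)
  also have "(\<lambda>N. (\<Prod>n<N. 1 - exp s * q ^ Suc n) * (\<Prod>n<N. 1 - exp (- s) * q ^ Suc n))
     = (\<lambda>N. \<Prod>n<N. 1 - (exp s + exp (- s)) * q ^ Suc n + q ^ (2 * Suc n))"
  proof -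
    have *: "(1 - u * a) * (1 - v * a) = 1 - (u + v) * a + a * a" if "u * v = 1" for u v a :: complex
    proof -
      have "(1 - u * a) * (1 - v * a) = 1 - (u + v) * a + (u * v) * (a * a)" by (simp add: algebra_simps)
      then show ?thesis using that by simp
    qed
    have sq: "q ^ (2 * Suc n) = q ^ Suc n * q ^ Suc n" for n by (simp only: mult_2 power_add)
    have ex: "exp s * exp (- s) = 1" by (simp add: exp_minus)
    show ?thesis by (simp only: prod.distrib[symmetric] *[OF ex] sq)
  qed
  finally show ?thesis by (simp add: thetalog_def exp_add[symmetric])
qed

lemma thetalog_has_derivative:
  assumes "norm q < 1" "Re s = 0"
  shows "((\<lambda>q. thetalog q s) has_field_derivative dthetalog q s) (at q)"
    and "q * dthetalog q s = phiq q s"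
proof -
  show "((\<lambda>q. thetalog q s) has_field_derivative dthetalog q s) (at q)"
    unfolding thetalog_def dthetalog_def
    using assms by (intro DERIV_minus DERIV_add lambert_has_derivative_q) auto
  show "q * dthetalog q s = phiq q s"
    using times_dlambert[OF assms(1), of s "- 1"] times_dlambert[OF assms(1), of "- s" "- 1"] assms(2)
    by (simp add: dthetalog_def phiq_def algebra_simps)
qed

lemma thetalog_0 [simp]: "thetalog 0 s = 0"
  by (simp add: thetalog_def)

lemma thetalog_has_derivative':
  assumes "norm q < 1" "Re s = 0" "q \<noteq> 0"
  shows "((\<lambda>q. thetalog q s) has_field_derivative phiq q s / q) (at q)"
  by (rule DERIV_cong[OF thetalog_has_derivative(1)[OF assms(1,2)]])
     (use thetalog_has_derivative(2)[OF assms(1,2)] assms(3) in \<open>auto simp: field_simps\<close>)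

text \<open>The two functions of the theorem in the variable \<open>q\<close>. In \<open>Tq\<close> the factors \<open>1 - q^(5n)\<close> have been split into the
factors \<open>1 - q^n\<close> and the two golden quadratic factors, which leaves squares and cubes of theta products.\<close>

definition fq :: "complex \<Rightarrow> complex" where
  "fq q = of_real sing_plus * exp (5 * (thetalog q tors1 - thetalog q tors2))"

definition Tq :: "complex \<Rightarrow> complex" where
  "Tq q = of_real (sqrt (250 + 110 * sqrt 5) / 5) * exp (thetalog q 0 + 2 * thetalog q tors2 - 3 * thetalog q tors1)"

lemma sing_plus_neq_0: "sing_plus \<noteq> 0"
proof
  assume "sing_plus = 0"
  then have "sqrt 5 = 11 / 5" by (simp add: sing_plus_def)
  then have "5 = (11 / 5 :: real) ^ 2" by (metis real_sqrt_pow2 zero_le_numeral)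
  then show False by (simp add: power2_eq_square)
qed

lemma fq_neq_0: "fq q \<noteq> 0" 
  using sing_plus_neq_0 by (simp add: fq_def)

lemma Tq_neq_0: "Tq q \<noteq> 0"
proof -
  have "sqrt (250 + 110 * sqrt 5) > (0::real)" by (intro real_sqrt_gt_zero add_pos_nonneg) auto
  then have "complex_of_real (sqrt (250 + 110 * sqrt 5) / 5) \<noteq> 0" by (metis of_real_eq_0_iff divide_eq_0_iff less_irrefl zero_neq_numeral)
  then show ?thesis unfolding Tq_def by simp
qed

lemma fq_has_derivative:
  assumes q: "norm q < 1" "q \<noteq> 0"
  shows "(fq has_field_derivative fq q * (- 5 * (eisX q ^ 2 - 4 * eisX q * eisY q - eisY q ^ 2)) / q) (at q)"
proof -
  have "(fq has_field_derivative fq q * (5 * (phiq q tors1 / q - phiq q tors2 / q))) (at q)"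
    unfolding fq_def[abs_def]
    apply (rule derivative_eq_intros thetalog_has_derivative' q Re_tors refl | simp)+
    apply (simp add: mult.commute)
    done
  moreover have "5 * (phiq q tors1 / q - phiq q tors2 / q) = (- 5 * (eisX q ^ 2 - 4 * eisX q * eisY q - eisY q ^ 2)) / q"
    unfolding phiq_tors[OF q(2,1)] using q by (simp add: field_simps)
  ultimately show ?thesis by simp
qed

text \<open>The \<open>q d/dq\<close>-logarithmic derivative of \<open>Tq\<close>, written in \<open>x, y, e\<close>.\<close>

definition dlog_Tq :: "complex \<Rightarrow> complex" where
  "dlog_Tq q = eisE q + (8 * eisX q ^ 2 - 30 * eisX q * eisY q - 7 * eisY q ^ 2) / 3"

lemma Tq_has_derivative:
  assumes q: "norm q < 1" "q \<noteq> 0"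
  shows "(Tq has_field_derivative Tq q * (dlog_Tq q / q)) (at q)"
proof -
  have "(Tq has_field_derivative Tq q * (phiq q 0 / q + 2 * (phiq q tors2 / q) - 3 * (phiq q tors1 / q))) (at q)"
    unfolding Tq_def[abs_def]
    apply (rule derivative_eq_intros thetalog_has_derivative' q Re_tors refl | simp)+
    apply (simp add: mult.commute)
    done
  moreover have "phiq q 0 / q + 2 * (phiq q tors2 / q) - 3 * (phiq q tors1 / q) = dlog_Tq q / q"
    unfolding phiq_tors[OF q(2,1)] phiq_0[OF q(2,1)] dlog_Tq_def using q by (simp add: field_simps)
  ultimately show ?thesis by simp
qed

text \<open>A finite exceptional set is allowed because the derivative formulas contain \<open>1/q\<close> and say nothing at \<open>q = 0\<close>.\<close>

lemma proportional_of_same_log_derivative: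
  fixes f g :: "complex \<Rightarrow> complex"
  assumes S: "open S" "connected S" "finite Z"
    and hol: "f holomorphic_on S" "g holomorphic_on S" and nz: "\<And>q. q \<in> S \<Longrightarrow> g q \<noteq> 0"
    and f: "\<And>q. q \<in> S - Z \<Longrightarrow> (f has_field_derivative f q * k q) (at q)"
    and g: "\<And>q. q \<in> S - Z \<Longrightarrow> (g has_field_derivative g q * k q) (at q)"
  obtains c where "\<And>q. q \<in> S \<Longrightarrow> f q = c * g q"
proof -
  have "continuous_on S (\<lambda>q. f q / g q)"
    using hol nz by (intro continuous_on_divide holomorphic_on_imp_continuous_on) auto
  moreover have "\<forall>q\<in>S - Z. ((\<lambda>q. f q / g q) has_field_derivative 0) (at q)"
  proof
    fix q assume q: "q \<in> S - Z"
    show "((\<lambda>q. f q / g q) has_field_derivative 0) (at q)"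
      by (rule DERIV_cong[OF DERIV_divide[OF f[OF q] g[OF q]]]) (use nz q in auto)
  qed
  ultimately obtain c where "\<And>q. q \<in> S \<Longrightarrow> f q / g q = c"
    using DERIV_zero_connected_constant[OF S(2,1,3)] by blast
  then have "f q = c * g q" if "q \<in> S" for q using that nz by (auto simp: field_simps)
  then show ?thesis using that by blast
qed

lemma thetalog_holomorphic: "Re s = 0 \<Longrightarrow> (\<lambda>q. thetalog q s) holomorphic_on ball 0 1"
  using thetalog_has_derivative(1) by (auto simp: holomorphic_on_open) blast

lemma fq_Tq_holomorphic: "fq holomorphic_on ball 0 1" "Tq holomorphic_on ball 0 1"
  unfolding fq_def[abs_def] Tq_def[abs_def] by (intro holomorphic_intros thetalog_holomorphic; simp)+

text \<open>At \<open>q = 0\<close> only the cotangents survive: \<open>(1 + exp (\<i> t)) / (1 - exp (\<i> t)) = \<i> sin t / (1 - cos t)\<close>, evaluated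
with the golden ratio values of the cosine.\<close>

lemma eis_at_0:
  "3 * eisX 0 + eisY 0 = \<i> / 2 * Tq 0"
  "eisX 0 - 3 * eisY 0 = \<i> / 2 * (fq 0 * Tq 0)"
proof -
  define r where "r = sqrt (5::real)"
  have r: "r ^ 2 = 5" "r > 0" by (simp_all add: r_def)
  define s where "s = sin (2 * pi / 5)"
  have s: "s > 0" unfolding s_def by (rule sin_gt_zero) (auto simp: field_simps)
  have s2: "s ^ 2 = (10 + 2 * r) / 16"
    using sin_squared_eq[of "2 * pi / 5"] r unfolding s_def[symmetric] cos_fifth r_def[symmetric]
    by (simp add: power2_eq_square field_simps)
  have c: "(1 + exp (of_real t * \<i>)) / (2 * (1 - exp (of_real t * \<i>))) = \<i> / 2 * of_real (sin t / (1 - cos t))"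
    if "cos t \<noteq> 1" for t
  proof -
    define C S where "C = complex_of_real (cos t)" and "S = complex_of_real (sin t)"
    have 1: "C ^ 2 + S ^ 2 = 1" unfolding C_def S_def by (metis of_real_1 of_real_add of_real_power sin_cos_squared_add2)
    have 2: "1 - C \<noteq> 0" using that by (simp add: C_def)
    have 3: "1 - (C + \<i> * S) \<noteq> 0"
    proof
      assume "1 - (C + \<i> * S) = 0"
      then have "Re (1 - (C + \<i> * S)) = 0" by simp
      then show False using that by (simp add: C_def S_def)
    qed
    have 4: "(1 + (C + \<i> * S)) * (1 - C) = \<i> * S * (1 - (C + \<i> * S))"
      using 1 by (simp add: power2_eq_square algebra_simps)
    have "(1 + (C + \<i> * S)) / (1 - (C + \<i> * S)) = \<i> * S / (1 - C)"
      by (rule frac_eq_eq[THEN iffD2, OF 3 2 4])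
    then have "(1 + (C + \<i> * S)) / (1 - (C + \<i> * S)) / 2 = \<i> * S / (1 - C) / 2" by simp
    then have "(1 + (C + \<i> * S)) / (2 * (1 - (C + \<i> * S))) = \<i> / 2 * (S / (1 - C))"
      by (simp add: mult.commute)
    then show ?thesis unfolding exp_imaginary by (simp add: C_def S_def)
  qed
  have c1: "1 - cos (2 * pi / 5) = (5 - r) / 4" "1 - cos (4 * pi / 5) = (5 + r) / 4"
    unfolding cos_fifth r_def by (simp_all add: field_simps)
  have r5: "r < 5" using r by (intro power2_less_imp_less[of r 5]) auto
  have s4: "sin (4 * pi / 5) = 2 * s * ((r - 1) / 4)"
    using sin_double[of "2 * pi / 5"] unfolding cos_fifth r_def s_def by simp
  have x0: "eisX 0 = \<i> / 2 * of_real (s / ((5 - r) / 4))"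
    using c[of "2 * pi / 5"] c1 r5 by (simp add: eisX_def zetaq_def tors1_def s_def)
  have y0: "eisY 0 = \<i> / 2 * of_real (2 * s * ((r - 1) / 4) / ((5 + r) / 4))"
    using c[of "4 * pi / 5"] c1 r by (simp add: eisY_def zetaq_def tors2_def s4)
  define T0 where "T0 = sqrt (250 + 110 * r) / 5"
  have T0: "Tq 0 = of_real T0" by (simp add: Tq_def T0_def r_def)
  have f0: "fq 0 = of_real ((- 11 + 5 * r) / 2)" by (simp add: fq_def sing_plus_def r_def)
  have inv: "1 / ((5 - r) / 4) = (5 + r) / 5" "1 / ((5 + r) / 4) = (5 - r) / 5"
    using r r5 by (simp_all add: divide_simps) (simp_all add: algebra_simps power2_eq_square)
  have e1: "s / ((5 - r) / 4) = s * ((5 + r) / 5)"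
    unfolding inv(1)[symmetric] by (simp only: times_divide_eq_right mult_1_right)
  have e2: "2 * s * ((r - 1) / 4) / ((5 + r) / 4) = 2 * s * ((r - 1) / 4) * ((5 - r) / 5)"
    unfolding inv(2)[symmetric] by (simp only: times_divide_eq_right mult_1_right)
  have t: "T0 = s * (10 + 6 * r) / 5"
  proof (rule power2_eq_imp_eq)
    have "T0 ^ 2 = (250 + 110 * r) / 25" using r(2) by (simp add: T0_def power_divide)
    moreover have "(s * (10 + 6 * r) / 5) ^ 2 = s ^ 2 * (10 + 6 * r) ^ 2 / 25"
      by (simp add: power_mult_distrib power_divide)
    moreover have "(10 + 2 * r) * (10 + 6 * r) ^ 2 = 16 * (250 + 110 * r)"
    proof -
      have "(10 + 2 * r) * (10 + 6 * r) ^ 2 = 1000 + 1400 * r + 600 * r ^ 2 + 72 * (r * r ^ 2)"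
        by (simp add: power2_eq_square algebra_simps)
      then show ?thesis unfolding r(1) by simp
    qed
    ultimately show "T0 ^ 2 = (s * (10 + 6 * r) / 5) ^ 2" by (simp add: s2)
    show "T0 \<ge> 0" "s * (10 + 6 * r) / 5 \<ge> 0" using r(2) s by (auto simp: T0_def)
  qed
  have t1: "3 * (s / ((5 - r) / 4)) + 2 * s * ((r - 1) / 4) / ((5 + r) / 4) = T0"
  proof -
    have "3 * (s * ((5 + r) / 5)) + 2 * s * ((r - 1) / 4) * ((5 - r) / 5) = s * (25 + 12 * r - r ^ 2) / 10"
      by (simp add: field_simps power2_eq_square)
    then show ?thesis unfolding e1 e2 t r(1) by (simp add: field_simps)
  qed
  have t2: "s / ((5 - r) / 4) - 3 * (2 * s * ((r - 1) / 4) / ((5 + r) / 4)) = (- 11 + 5 * r) / 2 * T0"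
  proof -
    have "s * ((5 + r) / 5) - 3 * (2 * s * ((r - 1) / 4) * ((5 - r) / 5)) = s * (25 - 16 * r + 3 * r ^ 2) / 10"
      "(- 11 + 5 * r) / 2 * (s * (10 + 6 * r) / 5) = s * (- 110 - 16 * r + 30 * r ^ 2) / 10"
      by (simp_all add: field_simps power2_eq_square)
    then show ?thesis unfolding e1 e2 t r(1) by (simp only:) simp
  qed
  show "3 * eisX 0 + eisY 0 = \<i> / 2 * Tq 0"
    unfolding x0 y0 T0 t1[symmetric] by (simp add: algebra_simps)
  show "eisX 0 - 3 * eisY 0 = \<i> / 2 * (fq 0 * Tq 0)"
    unfolding x0 y0 T0 f0 of_real_mult[symmetric] t2[symmetric] by (simp add: algebra_simps)
qed

text \<open>Each side satisfies the same first order linear equation, so the two are proportional on the disc, and \<open>q = 0\<close> fixes the factor.\<close>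

lemma eis_eq_products:
  assumes q: "norm q < 1"
  shows "3 * eisX q + eisY q = \<i> / 2 * Tq q"
    and "eisX q - 3 * eisY q = \<i> / 2 * (fq q * Tq q)"
proof -
  have q: "q \<in> ball 0 1" using q by simp
  have S: "open (ball (0::complex) 1)" "connected (ball (0::complex) 1)" "finite {0::complex}" by auto
  note hol = eis_holomorphic fq_Tq_holomorphic
  have 1: "((\<lambda>q. 3 * eisX q + eisY q) has_field_derivative (3 * eisX q + eisY q) * (dlog_Tq q / q)) (at q)"
    if "q \<in> ball 0 1 - {0}" for q
    using that by (auto intro!: derivative_eq_intros eis_has_derivative(1,2)) (simp add: field_simps dlog_Tq_def power2_eq_square power3_eq_cube)
  obtain c where c: "\<And>q. q \<in> ball 0 1 \<Longrightarrow> 3 * eisX q + eisY q = c * Tq q"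
    by (rule proportional_of_same_log_derivative[OF S _ fq_Tq_holomorphic(2) Tq_neq_0 1 Tq_has_derivative])
       (auto intro!: holomorphic_intros hol)
  from c[of 0] eis_at_0(1) Tq_neq_0[of 0] have "c = \<i> / 2" by simp
  then show "3 * eisX q + eisY q = \<i> / 2 * Tq q" using c[OF q] by simp
  define k where "k = (\<lambda>q. (dlog_Tq q - 5 * (eisX q ^ 2 - 4 * eisX q * eisY q - eisY q ^ 2)) / q)"
  have 2: "((\<lambda>q. eisX q - 3 * eisY q) has_field_derivative (eisX q - 3 * eisY q) * k q) (at q)"
    if "q \<in> ball 0 1 - {0}" for q
    using that by (auto intro!: derivative_eq_intros eis_has_derivative(1,2)) (simp add: field_simps dlog_Tq_def k_def power2_eq_square power3_eq_cube)
  have 3: "((\<lambda>q. fq q * Tq q) has_field_derivative (fq q * Tq q) * k q) (at q)"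
    if "q \<in> ball 0 1 - {0}" for q
    using that by (auto intro!: derivative_eq_intros fq_has_derivative Tq_has_derivative) (simp add: field_simps k_def)
  obtain d where d: "\<And>q. q \<in> ball 0 1 \<Longrightarrow> eisX q - 3 * eisY q = d * (fq q * Tq q)"
    by (rule proportional_of_same_log_derivative[OF S _ _ _ 2 3])
       (auto intro!: holomorphic_intros hol simp: Tq_neq_0 fq_neq_0)
  from d[of 0] eis_at_0(2) Tq_neq_0[of 0] fq_neq_0[of 0] have "d = \<i> / 2" by simp
  then show "eisX q - 3 * eisY q = \<i> / 2 * (fq q * Tq q)" using d[OF q] by simp
qed

text \<open>Here \<open>W = x^2 - 4xy - y^2\<close> has the same logarithmic derivative as \<open>q\<close> times a nonvanishing product (classically
\<open>\<eta>(5\<tau>)^5/\<eta>(\<tau>)\<close>), so a single zero would force \<open>W\<close> to vanish identically. Then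
\<open>\<theta>(s\<^sub>1)/\<theta>(s\<^sub>2)\<close> would be constant in \<open>q\<close>, although the expansion of its logarithm has linear coefficient \<open>- sqrt 5\<close>.\<close>

lemma wronskian_nonzero:
  assumes q: "norm q < 1" "q \<noteq> 0"
  shows "eisX q ^ 2 - 4 * eisX q * eisY q - eisY q ^ 2 \<noteq> 0"
proof
  assume zero: "eisX q ^ 2 - 4 * eisX q * eisY q - eisY q ^ 2 = 0"
  define W where "W = (\<lambda>q. eisX q ^ 2 - 4 * eisX q * eisY q - eisY q ^ 2)"
  \<comment> \<open>\<open>V\<close> is \<open>\<eta>(5\<tau>)^5/\<eta>(\<tau>)\<close> as a product.\<close>
  define V where "V = (\<lambda>q. q * exp (2 * thetalog q 0 + 5 * (thetalog q tors1 + thetalog q tors2)))"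
  define k where "k = (\<lambda>q. (2 * eisE q - 5 * (eisX q ^ 2 + eisY q ^ 2) / 3) / q)"
  define S where "S = ball (0::complex) 1 - {0}"
  have S: "open S" "connected S" unfolding S_def by (auto intro!: connected_punctured_ball)
  have sub: "S \<subseteq> ball 0 1" by (auto simp: S_def)
  have 1: "(W has_field_derivative W q * k q) (at q)" if "q \<in> S" for q
    using that unfolding W_def S_def
    by (auto intro!: derivative_eq_intros eis_has_derivative(1,2)) (simp add: field_simps k_def power2_eq_square power3_eq_cube)
  have 2: "(V has_field_derivative V q * k q) (at q)" if "q \<in> S" for q
  proof -
    have q: "norm q < 1" "q \<noteq> 0" using that by (auto simp: S_def)
    have "(V has_field_derivative V q * (1 / q + (2 * (phiq q 0 / q) + 5 * (phiq q tors1 / q + phiq q tors2 / q)))) (at q)"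
      unfolding V_def
      apply (rule derivative_eq_intros thetalog_has_derivative' q Re_tors refl | simp)+
      using q by (simp add: field_simps)
    moreover have "1 / q + (2 * (phiq q 0 / q) + 5 * (phiq q tors1 / q + phiq q tors2 / q)) = k q"
      unfolding k_def phiq_tors[OF q(2,1)] phiq_0[OF q(2,1)] using q by (simp add: field_simps)
    ultimately show ?thesis by simp
  qed
  have hol: "W holomorphic_on S" "V holomorphic_on S"
    unfolding W_def V_def
    by (intro holomorphic_intros holomorphic_on_subset[OF _ sub] eis_holomorphic thetalog_holomorphic; simp)+
  obtain c where c: "\<And>q. q \<in> S \<Longrightarrow> W q = c * V q"
    by (rule proportional_of_same_log_derivative[OF S finite.emptyI hol _ , of k]) (use 1 2 in \<open>auto simp: V_def S_def\<close>)
  have "c = 0" using c[of q] zero q by (auto simp: W_def V_def S_def)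
  then have Wz: "W q = 0" if "q \<in> S" for q using c that by simp
  have "\<forall>q\<in>ball 0 1 - {0}. ((\<lambda>q. thetalog q tors1 - thetalog q tors2) has_field_derivative 0) (at q)"
  proof
    fix q :: complex assume "q \<in> ball 0 1 - {0}"
    then have q: "norm q < 1" "q \<noteq> 0" "q \<in> S" by (auto simp: S_def)
    have "(6 * x * y - 2 * x ^ 2 + y ^ 2) / 3 - 1 / 12 - ((- 6 * x * y - 2 * y ^ 2 + x ^ 2) / 3 - 1 / 12)
        = - (x ^ 2 - 4 * x * y - y ^ 2)" for x y :: complex
      by (simp add: field_simps)
    from this[of "eisX q" "eisY q"] have "phiq q tors1 = phiq q tors2"
      using Wz[OF q(3)] unfolding W_def phiq_tors[OF q(2,1)] by simp
    then show "((\<lambda>q. thetalog q tors1 - thetalog q tors2) has_field_derivative 0) (at q)"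
      using DERIV_diff[OF thetalog_has_derivative'[OF q(1) _ q(2), of tors1] thetalog_has_derivative'[OF q(1) _ q(2), of tors2]] by simp
  qed
  moreover have "continuous_on (ball 0 1) (\<lambda>q. thetalog q tors1 - thetalog q tors2)"
    by (intro holomorphic_on_imp_continuous_on holomorphic_intros thetalog_holomorphic) auto
  ultimately obtain d where d: "\<And>q. q \<in> ball 0 1 \<Longrightarrow> thetalog q tors1 - thetalog q tors2 = d"
    using DERIV_zero_connected_constant[of "ball 0 1" "{0}" "\<lambda>q. thetalog q tors1 - thetalog q tors2"] by auto
  have "\<forall>\<^sub>F q in nhds 0. q \<in> ball (0::complex) 1" by (intro eventually_nhds_in_open) auto
  then have "\<forall>\<^sub>F q in nhds 0. thetalog q tors1 - thetalog q tors2 = d" by eventually_elim (rule d)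
  from has_derivative_zero_of_eventually_constant[OF this DERIV_diff[OF thetalog_has_derivative(1) thetalog_has_derivative(1)]]
  have "dthetalog 0 tors1 - dthetalog 0 tors2 = 0" by simp
  then have "(exp tors2 + exp (- tors2)) - (exp tors1 + exp (- tors1)) = 0"
    unfolding dthetalog_def dlambert_0 by algebra
  then have "complex_of_real (- (sqrt 5 + 1) / 2 - (sqrt 5 - 1) / 2) = 0"
    unfolding exp_plus_exp_minus_tors by simp
  then have "- (sqrt 5 + 1) / 2 - (sqrt 5 - 1) / 2 = (0::real)" by (metis of_real_eq_0_iff)
  then show False by (simp add: field_simps)
qed

section \<open>From the nome to the Hauptmodul\<close>

lemma prodinf_eq_limit:
  fixes f :: "nat \<Rightarrow> complex"
  assumes "(\<lambda>N. \<Prod>n<N. f n) \<longlonglongrightarrow> p" "p \<noteq> 0"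
  shows "prodinf f = p"
proof -
  have "(\<lambda>N. \<Prod>n\<le>N. f n) \<longlonglongrightarrow> p"
    using LIMSEQ_Suc[OF assms(1)] by (simp add: lessThan_Suc_atMost)
  then have "f has_prod p" using assms(2) by (simp add: has_prod_def raw_has_prod_def)
  then show ?thesis using has_prod_unique by metis
qed

lemma norm_nome: "\<tau> \<in> upper_half_plane \<Longrightarrow> norm (nome \<tau>) < 1"
  by (simp add: upper_half_plane_def nome_def)

lemma nome_neq_0: "nome \<tau> \<noteq> 0"
  by (simp add: nome_def)

lemma open_upper_half_plane: "open upper_half_plane"
  unfolding upper_half_plane_def by (rule open_halfspace_Im_gt)

lemma quadratic_factor_products:
  assumes q: "norm q < 1"
  shows "(\<lambda>N. \<Prod>n<N. 1 + of_real ((1 - sqrt 5) / 2) * q ^ Suc n + q ^ (2 * Suc n)) \<longlonglongrightarrow> exp (thetalog q tors1)"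
    and "(\<lambda>N. \<Prod>n<N. 1 + of_real ((1 + sqrt 5) / 2) * q ^ Suc n + q ^ (2 * Suc n)) \<longlonglongrightarrow> exp (thetalog q tors2)"
    and "(\<lambda>N. \<Prod>n<N. (1 - q ^ Suc n) ^ 2) \<longlonglongrightarrow> exp (thetalog q 0)"
proof -
  have 1: "1 - of_real ((sqrt 5 - 1) / 2) * w + v = 1 + of_real ((1 - sqrt 5) / 2) * w + v"
    "1 - of_real (- (sqrt 5 + 1) / 2) * w + v = 1 + of_real ((1 + sqrt 5) / 2) * w + v" for w v :: complex
    by (simp_all add: field_simps)
  show "(\<lambda>N. \<Prod>n<N. 1 + of_real ((1 - sqrt 5) / 2) * q ^ Suc n + q ^ (2 * Suc n)) \<longlonglongrightarrow> exp (thetalog q tors1)"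
    using theta_product_tendsto[OF q Re_tors(1)] unfolding exp_plus_exp_minus_tors 1 .
  show "(\<lambda>N. \<Prod>n<N. 1 + of_real ((1 + sqrt 5) / 2) * q ^ Suc n + q ^ (2 * Suc n)) \<longlonglongrightarrow> exp (thetalog q tors2)"
    using theta_product_tendsto[OF q Re_tors(2)] unfolding exp_plus_exp_minus_tors 1 .
  have "1 - (exp 0 + exp (- 0)) * q ^ Suc n + q ^ (2 * Suc n) = (1 - q ^ Suc n) ^ 2" for n
  proof -
    have "q ^ (2 * Suc n) = q ^ Suc n * q ^ Suc n" by (simp only: mult_2 power_add)
    moreover have "1 - (exp 0 + exp (- 0)) * w + w * w = (1 - w) ^ 2" for w :: complex
      by (simp add: power2_eq_square algebra_simps)
    ultimately show ?thesis by metis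
  qed
  then show "(\<lambda>N. \<Prod>n<N. (1 - q ^ Suc n) ^ 2) \<longlonglongrightarrow> exp (thetalog q 0)"
    using theta_product_tendsto[OF q, of 0] by (simp only: zero_complex.sel)
qed

lemma ftilde_eq:
  assumes "\<tau> \<in> upper_half_plane"
  shows "ftilde \<tau> = fq (nome \<tau>)"
proof -
  define q where "q = nome \<tau>"
  have q: "norm q < 1" using norm_nome[OF assms] by (simp add: q_def)
  have "(\<lambda>N. (\<Prod>n<N. 1 + of_real ((1 - sqrt 5) / 2) * q ^ Suc n + q ^ (2 * Suc n)) ^ 5 /
         (\<Prod>n<N. 1 + of_real ((1 + sqrt 5) / 2) * q ^ Suc n + q ^ (2 * Suc n)) ^ 5)
      \<longlonglongrightarrow> exp (thetalog q tors1) ^ 5 / exp (thetalog q tors2) ^ 5"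
    by (intro tendsto_divide tendsto_power quadratic_factor_products q) simp
  then have "(\<lambda>N. \<Prod>n<N. (1 + of_real ((1 - sqrt 5) / 2) * q ^ Suc n + q ^ (2 * Suc n)) ^ 5 /
         (1 + of_real ((1 + sqrt 5) / 2) * q ^ Suc n + q ^ (2 * Suc n)) ^ 5)
      \<longlonglongrightarrow> exp (thetalog q tors1) ^ 5 / exp (thetalog q tors2) ^ 5"
    by (simp only: prod_dividef prod_power_distrib)
  moreover have "exp (thetalog q tors1) ^ 5 / exp (thetalog q tors2) ^ 5 = exp (5 * (thetalog q tors1 - thetalog q tors2))"
    using exp_of_nat_mult[of 5 "thetalog q tors1 - thetalog q tors2"] by (simp add: exp_diff power_divide)
  ultimately show ?thesis
    using prodinf_eq_limit unfolding ftilde_def fq_def Let_def q_def[symmetric] by (simp only: exp_not_eq_zero not_False_eq_True simp_thms)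
qed

text \<open>The two golden quadratics are the factors over \<open>\<rat>(sqrt 5)\<close> of the fifth cyclotomic polynomial.\<close>

lemma golden_factorization:
  fixes w :: complex
  shows "1 - w ^ 5 = (1 - w) * (1 + of_real ((1 - sqrt 5) / 2) * w + w ^ 2) * (1 + of_real ((1 + sqrt 5) / 2) * w + w ^ 2)"
proof -
  define a b where "a = complex_of_real ((1 - sqrt 5) / 2)" and "b = complex_of_real ((1 + sqrt 5) / 2)"
  have "a + b = of_real ((1 - sqrt 5) / 2 + (1 + sqrt 5) / 2)" by (simp only: a_def b_def of_real_add)
  also have "(1 - sqrt 5) / 2 + (1 + sqrt 5) / 2 = (1::real)" by (simp add: field_simps)
  finally have s: "a + b = 1" by simp
  have "a * b = of_real ((1 - sqrt 5) / 2 * ((1 + sqrt 5) / 2))" by (simp only: a_def b_def of_real_mult)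
  also have "(1 - sqrt 5) / 2 * ((1 + sqrt 5) / 2) = (- 1::real)" by (simp add: algebra_simps)
  finally have p: "a * b = - 1" by simp
  have "(1 - w) * (1 + a * w + w ^ 2) * (1 + b * w + w ^ 2)
      = (1 - w) * (1 + (a + b) * w + (2 + a * b) * w ^ 2 + (a + b) * w ^ 3 + w ^ 4)"
    by (simp add: algebra_simps power2_eq_square power3_eq_cube power4_eq_xxxx)
  also have "\<dots> = 1 - w ^ 5" unfolding s p by (simp add: algebra_simps power2_eq_square power3_eq_cube power4_eq_xxxx eval_nat_numeral)
  finally show ?thesis by (simp add: a_def b_def)
qed

lemma Tfun_eq:
  assumes "\<tau> \<in> upper_half_plane"
  shows "Tfun \<tau> = Tq (nome \<tau>)"
proof -
  define q where "q = nome \<tau>"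
  have q: "norm q < 1" using norm_nome[OF assms] by (simp add: q_def)
  define A B where "A = (\<lambda>n. 1 + of_real ((1 - sqrt 5) / 2) * q ^ Suc n + q ^ (2 * Suc n))"
    and "B = (\<lambda>n. 1 + of_real ((1 + sqrt 5) / 2) * q ^ Suc n + q ^ (2 * Suc n))"
  have "(\<lambda>N. (\<Prod>n<N. (1 - q ^ Suc n) ^ 2) * (\<Prod>n<N. B n) ^ 2 / (\<Prod>n<N. A n) ^ 3)
      \<longlonglongrightarrow> exp (thetalog q 0) * exp (thetalog q tors2) ^ 2 / exp (thetalog q tors1) ^ 3"
    unfolding A_def B_def
    by (intro tendsto_divide tendsto_mult tendsto_power quadratic_factor_products q) simp
  then have "(\<lambda>N. \<Prod>n<N. (1 - q ^ Suc n) ^ 2 * B n ^ 2 / A n ^ 3)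
      \<longlonglongrightarrow> exp (thetalog q 0) * exp (thetalog q tors2) ^ 2 / exp (thetalog q tors1) ^ 3"
    by (simp only: prod_dividef prod_power_distrib prod.distrib)
  also have "(\<lambda>n. (1 - q ^ Suc n) ^ 2 * B n ^ 2 / A n ^ 3) = (\<lambda>n. (1 - q ^ Suc n) ^ 5 / (1 - q ^ (5 * Suc n)) ^ 3 * B n ^ 5)"
  proof
    fix n
    define w where "w = q ^ Suc n"
    have w2: "q ^ (2 * Suc n) = w ^ 2" and w5: "q ^ (5 * Suc n) = w ^ 5"
      by (simp_all only: w_def power_mult[symmetric] mult.commute)
    have "1 - w ^ 5 = (1 - w) * A n * B n"
      unfolding A_def B_def w2 w_def[symmetric] by (rule golden_factorization)
    moreover have "q ^ (5 * Suc n) \<noteq> 1" by (rule power_neq_1_of_norm_less_1[OF q]) simp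
    then have "1 - w ^ 5 \<noteq> 0" unfolding w5 by simp
    moreover have "(1 - w) ^ 2 * b ^ 2 / a ^ 3 = (1 - w) ^ 5 / ((1 - w) * a * b) ^ 3 * b ^ 5"
      if "(1 - w) * a * b \<noteq> 0" for a b
    proof -
      have eqs: "(1 - w) ^ 5 = (1 - w) ^ 3 * (1 - w) ^ 2" "b ^ 5 = b ^ 3 * b ^ 2" by (simp_all flip: power_add)
      have "c * d / z = P * c / (P * z * Q) * (Q * d)" if "P \<noteq> 0" "Q \<noteq> 0" for c d z P Q :: complex
        using that by simp
      from this[of "(1 - w) ^ 3" "b ^ 3" "(1 - w) ^ 2" "b ^ 2" "a ^ 3"] show ?thesis
        unfolding eqs power_mult_distrib using that by (simp only: mult_eq_0_iff power_eq_0_iff de_Morgan_disj simp_thms)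
    qed
    ultimately show "(1 - q ^ Suc n) ^ 2 * B n ^ 2 / A n ^ 3 = (1 - q ^ Suc n) ^ 5 / (1 - q ^ (5 * Suc n)) ^ 3 * B n ^ 5"
      unfolding w5 w_def[symmetric] by metis
  qed
  finally have lim: "(\<lambda>N. \<Prod>n<N. (1 - q ^ Suc n) ^ 5 / (1 - q ^ (5 * Suc n)) ^ 3 * B n ^ 5)
      \<longlonglongrightarrow> exp (thetalog q 0) * exp (thetalog q tors2) ^ 2 / exp (thetalog q tors1) ^ 3" .
  have "(\<Prod>n. (1 - q ^ Suc n) ^ 5 / (1 - q ^ (5 * Suc n)) ^ 3 * B n ^ 5)
       = exp (thetalog q 0) * exp (thetalog q tors2) ^ 2 / exp (thetalog q tors1) ^ 3"
    by (rule prodinf_eq_limit[OF lim]) simp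
  also have "\<dots> = exp (thetalog q 0 + 2 * thetalog q tors2 - 3 * thetalog q tors1)"
    using exp_of_nat_mult[of 2 "thetalog q tors2"] exp_of_nat_mult[of 3 "thetalog q tors1"] by (simp add: exp_diff exp_add)
  finally show ?thesis
    unfolding Tfun_def Tq_def Let_def q_def[symmetric] B_def by simp
qed

lemma has_field_derivative_cong_nhds:
  assumes "(f has_field_derivative D) (at a)" "\<forall>\<^sub>F z in nhds a. h z = f z"
  shows "(h has_field_derivative D) (at a)"
  using DERIV_cong_ev[OF refl assms(2) refl] assms(1) by simp

lemma nome_has_derivative: "(nome has_field_derivative 2 * of_real pi * \<i> * nome \<tau>) (at \<tau>)"
  unfolding nome_def[abs_def] by (auto intro!: derivative_eq_intros)

lemma ftilde_has_derivative:
  assumes t: "\<tau> \<in> upper_half_plane"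
  shows "(ftilde has_field_derivative
    ftilde \<tau> * (- 10 * of_real pi * \<i> * (eisX (nome \<tau>) ^ 2 - 4 * eisX (nome \<tau>) * eisY (nome \<tau>) - eisY (nome \<tau>) ^ 2))) (at \<tau>)"
proof -
  have "((\<lambda>\<tau>. fq (nome \<tau>)) has_field_derivative
      ftilde \<tau> * (- 10 * of_real pi * \<i> * (eisX (nome \<tau>) ^ 2 - 4 * eisX (nome \<tau>) * eisY (nome \<tau>) - eisY (nome \<tau>) ^ 2))) (at \<tau>)"
  proof -
    have "a * (- 5 * W) / n * (2 * p * \<i> * n) = a * (- 10 * p * \<i> * W)" if "n \<noteq> 0" for a n p W :: complex
      using that by (simp add: field_simps)
    from this[OF nome_neq_0] show ?thesis
      using DERIV_chain2[where f = fq and g = nome and x = \<tau> and s = UNIV,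
          OF fq_has_derivative[OF norm_nome[OF t] nome_neq_0] nome_has_derivative]
      unfolding ftilde_eq[OF t] by (simp only:)
  qed
  moreover have "\<forall>\<^sub>F \<tau> in nhds \<tau>. ftilde \<tau> = fq (nome \<tau>)"
    using eventually_nhds_in_open[OF open_upper_half_plane t] by eventually_elim (rule ftilde_eq)
  ultimately show ?thesis by (rule has_field_derivative_cong_nhds)
qed

text \<open>The singular points other than 0 are the two roots of the quadratic that occurs in the relation between \<open>f\<close> and \<open>W\<close>.\<close>

lemma sing_quadratic: "(w - of_real sing_plus) * (w - of_real sing_minus) = w ^ 2 + 11 * w - 1" for w :: complex
proof -
  have s: "complex_of_real sing_plus + of_real sing_minus = - 11"
  proof -
    have "sing_plus + sing_minus = - 11" by (simp add: sing_plus_def sing_minus_def field_simps)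
    then show ?thesis unfolding of_real_add[symmetric] by simp
  qed
  have "sing_plus * sing_minus = - 1" by (simp add: sing_plus_def sing_minus_def field_simps)
  then have p: "complex_of_real sing_plus * of_real sing_minus = - 1" unfolding of_real_mult[symmetric] by simp
  have "(w - of_real sing_plus) * (w - of_real sing_minus)
      = w ^ 2 - (complex_of_real sing_plus + of_real sing_minus) * w + complex_of_real sing_plus * of_real sing_minus"
    by (simp add: algebra_simps power2_eq_square)
  then show ?thesis unfolding s p by simp
qed

lemma ftilde_local_inverse_exists:
  assumes t: "\<tau> \<in> upper_half_plane"
  shows "\<exists>U g. local_holomorphic_inverse ftilde upper_half_plane U g \<and> ftilde \<tau> \<in> U \<and> g (ftilde \<tau>) = \<tau>"
proof -
  have hol: "ftilde holomorphic_on upper_half_plane"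
    using ftilde_has_derivative open_upper_half_plane by (auto simp: holomorphic_on_open)
  have "deriv ftilde \<tau> \<noteq> 0"
    using DERIV_imp_deriv[OF ftilde_has_derivative[OF t]] wronskian_nonzero[OF norm_nome[OF t] nome_neq_0]
      fq_neq_0[of "nome \<tau>"] ftilde_eq[OF t] by simp
  from has_complex_derivative_locally_invertible[OF hol t open_upper_half_plane this]
  obtain r where r: "r > 0" "ball \<tau> r \<subseteq> upper_half_plane" "open (ftilde ` ball \<tau> r)" "inj_on ftilde (ball \<tau> r)" .
  from holomorphic_has_inverse[OF holomorphic_on_subset[OF hol r(2)] open_ball r(4)]
  obtain g where g: "g holomorphic_on ftilde ` ball \<tau> r" "\<And>z. z \<in> ball \<tau> r \<Longrightarrow> deriv ftilde z * deriv g (ftilde z) = 1"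
    "\<And>z. z \<in> ball \<tau> r \<Longrightarrow> g (ftilde z) = z" by blast
  have "local_holomorphic_inverse ftilde upper_half_plane (ftilde ` ball \<tau> r) g"
    unfolding local_holomorphic_inverse_def using r g by auto
  moreover have "ftilde \<tau> \<in> ftilde ` ball \<tau> r" "g (ftilde \<tau>) = \<tau>" using r g by auto
  ultimately show ?thesis by blast
qed

text \<open>The differential system in terms of logarithmic derivatives: with \<open>X, Y, E\<close> the derivatives of \<open>x, y, e\<close>, the forms
\<open>3x + y\<close> and \<open>W\<close> are eigenvectors of the derivation, with eigenvalues \<open>K\<close> and \<open>k\<close>, and the third identity is
\<open>D K = K^2 - 10 x (x - 3y) W\<close>. The last one is the differential equation in disguise: it computes the second derivative of
\<open>1/(3x + y)\<close>.\<close>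

lemma eis_system_identities:
  fixes x y e :: complex
  defines "X \<equiv> (13 * x ^ 3 - 39 * x ^ 2 * y - 47 * x * y ^ 2 - 9 * y ^ 3) / 6 + x * e"
    and "Y \<equiv> (9 * x ^ 3 - 47 * x ^ 2 * y + 39 * x * y ^ 2 + 13 * y ^ 3) / 6 + y * e"
    and "E \<equiv> (5 * x ^ 4 + 15 * x ^ 3 * y - 155 * x ^ 2 * y ^ 2 - 15 * x * y ^ 3 + 5 * y ^ 4) / 9 + e ^ 2"
    and "W \<equiv> x ^ 2 - 4 * x * y - y ^ 2"
    and "K \<equiv> e + (8 * x ^ 2 - 30 * x * y - 7 * y ^ 2) / 3"
    and "k \<equiv> 2 * e - 5 * (x ^ 2 + y ^ 2) / 3"
  shows "3 * X + Y = (3 * x + y) * K"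
    and "2 * x * X - 4 * (X * y + x * Y) - 2 * y * Y = W * k"
    and "E + (16 * x * X - 30 * (X * y + x * Y) - 14 * y * Y) / 3 = K ^ 2 - 10 * x * (x - 3 * y) * W"
  unfolding X_def Y_def E_def W_def K_def k_def
  by (simp_all add: field_simps power2_eq_square power3_eq_cube power4_eq_xxxx)

text \<open>Clearing denominators and using \<open>w (3x + y) = x - 3y\<close> turns the second claim into
\<open>K (- 10 K + 5 k + (35x + 5y) (x - 3y)) = 0\<close>, where \<open>35x + 5y\<close> is \<open>(2w + 11) (3x + y)\<close> and the bracket vanishes identically. The three summands are the second, first and
zeroth order terms of the differential equation for \<open>- 2 \<i> (3x + y)\<close>, up to a common constant.\<close>

lemma ode_identity:
  fixes x y e w :: complex
  assumes w: "w * (3 * x + y) = x - 3 * y" and nz: "3 * x + y \<noteq> 0" "w \<noteq> 0"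
  defines "W \<equiv> x ^ 2 - 4 * x * y - y ^ 2"
  defines "K \<equiv> e + (8 * x ^ 2 - 30 * x * y - 7 * y ^ 2) / 3"
  defines "k \<equiv> 2 * e - 5 * (x ^ 2 + y ^ 2) / 3"
  defines "DK \<equiv> K ^ 2 - 10 * x * (x - 3 * y) * W"
  assumes W: "W \<noteq> 0"
  shows "w ^ 2 + 11 * w - 1 = 25 * W / (3 * x + y) ^ 2"
    and "(3 * x + y) * (- (K ^ 2 + DK) / 5 - K * W + K * k / 5) / (W * w) ^ 2
      + (1 / w + (2 * w + 11) / (w ^ 2 + 11 * w - 1)) * ((3 * x + y) * K / (W * w))
      - 5 * (w + 3) / (w * (w ^ 2 + 11 * w - 1)) * (3 * x + y) = 0"
proof -
  define t where "t = 3 * x + y"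
  have t: "t \<noteq> 0" using nz by (simp add: t_def)
  have wt: "w * t = x - 3 * y" using w by (simp add: t_def)
  have "(w ^ 2 + 11 * w - 1) * t ^ 2 = (w * t) ^ 2 + 11 * (w * t) * t - t ^ 2"
    by (simp add: power2_eq_square algebra_simps)
  also have "\<dots> = 25 * W" unfolding wt unfolding t_def W_def by (simp add: power2_eq_square algebra_simps)
  finally have Q: "w ^ 2 + 11 * w - 1 = 25 * W / t ^ 2" using t by (simp add: field_simps)
  then show "w ^ 2 + 11 * w - 1 = 25 * W / (3 * x + y) ^ 2" by (simp add: t_def)
  have "(2 * w + 11) * w * t ^ 2 = (2 * (w * t) + 11 * t) * (w * t)" "(w + 3) * w * t ^ 2 = (w * t + 3 * t) * (w * t)"
    by (simp_all add: power2_eq_square algebra_simps)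
  then have 1: "(2 * w + 11) * w * t ^ 2 = (35 * x + 5 * y) * (x - 3 * y)"
     and 2: "(w + 3) * w * t ^ 2 = 10 * x * (x - 3 * y)"
    unfolding wt unfolding t_def by (simp_all add: algebra_simps)
  have K: "- 10 * K + 5 * k + (35 * x + 5 * y) * (x - 3 * y) = 0"
    unfolding K_def k_def by (simp add: field_simps power2_eq_square)
  have "- 5 * (K ^ 2 + DK) + 5 * K * k + (2 * w + 11) * w * t ^ 2 * K - 5 * ((w + 3) * w * t ^ 2) * W
      = K * (- 10 * K + 5 * k + (35 * x + 5 * y) * (x - 3 * y))"
    unfolding 1 2 DK_def by (simp add: algebra_simps power2_eq_square)
  then have main: "- 5 * (K ^ 2 + DK) + 5 * K * k + (2 * w + 11) * w * t ^ 2 * K - 5 * ((w + 3) * w * t ^ 2) * W = 0"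
    unfolding K by simp
  have "t * (- (K ^ 2 + DK) / 5 - K * W + K * k / 5) / (W * w) ^ 2
      + (1 / w + (2 * w + 11) / (25 * W / t ^ 2)) * (t * K / (W * w))
      - 5 * (w + 3) / (w * (25 * W / t ^ 2)) * t
      = t * (- 5 * (K ^ 2 + DK) + 5 * K * k + (2 * w + 11) * w * t ^ 2 * K - 5 * ((w + 3) * w * t ^ 2) * W) / (25 * (W * w) ^ 2)"
    using W nz(2) t by (simp add: divide_simps) (simp add: algebra_simps power2_eq_square)
  also have "\<dots> = 0" unfolding main by simp
  finally show "(3 * x + y) * (- (K ^ 2 + DK) / 5 - K * W + K * k / 5) / (W * w) ^ 2
      + (1 / w + (2 * w + 11) / (w ^ 2 + 11 * w - 1)) * ((3 * x + y) * K / (W * w))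
      - 5 * (w + 3) / (w * (w ^ 2 + 11 * w - 1)) * (3 * x + y) = 0"
    unfolding Q by (simp only: t_def)
qed

text \<open>Along an inverse branch the chain rule replaces \<open>q d/dq\<close> by \<open>- 5 W w d/dw\<close>, because \<open>D f = - 5 W f\<close> and \<open>f\<close> is now
the coordinate \<open>w\<close>.\<close>

lemma Tfun_inverse_ode:
  assumes g: "local_holomorphic_inverse ftilde upper_half_plane U g"
  shows "(\<lambda>w. Tfun (g w)) holomorphic_on U"
    and "\<And>w. w \<in> U \<Longrightarrow> w \<noteq> 0 \<and> w \<noteq> of_real sing_plus \<and> w \<noteq> of_real sing_minus \<and>
               (deriv ^^ 2) (\<lambda>w. Tfun (g w)) w
               + (1 / w + 1 / (w - of_real sing_plus) + 1 / (w - of_real sing_minus))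
                   * deriv (\<lambda>w. Tfun (g w)) w
               + (w + 3) / (w * (w - of_real sing_plus) * (w - of_real sing_minus))
                   * Tfun (g w) = 0"
proof -
  have U: "open U" "g holomorphic_on U" and gH: "\<And>w. w \<in> U \<Longrightarrow> g w \<in> upper_half_plane" and inv: "\<And>w. w \<in> U \<Longrightarrow> ftilde (g w) = w"
    using g by (auto simp: local_holomorphic_inverse_def)
  define q x y e W where "q = (\<lambda>w. nome (g w))" and "x = (\<lambda>w. eisX (q w))" and "y = (\<lambda>w. eisY (q w))" and "e = (\<lambda>w. eisE (q w))"
    and "W = (\<lambda>w. x w ^ 2 - 4 * x w * y w - y w ^ 2)"
  have q: "norm (q w) < 1" "q w \<noteq> 0" if "w \<in> U" for w
    using norm_nome[OF gH[OF that]] nome_neq_0 by (auto simp: q_def)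
  have W: "W w \<noteq> 0" if "w \<in> U" for w
    using wronskian_nonzero[OF q[OF that]] by (simp add: W_def x_def y_def)
  have wq: "fq (q w) = w" if "w \<in> U" for w
    using inv[OF that] ftilde_eq[OF gH[OF that]] by (simp add: q_def)
  have w0: "w \<noteq> 0" if "w \<in> U" for w using wq[OF that] fq_neq_0 by metis
  have T: "Tfun (g w) = - 2 * \<i> * (3 * x w + y w)" if "w \<in> U" for w
  proof -
    have "- 2 * \<i> * (\<i> / 2 * z) = z" for z by (simp add: complex_eq_iff)
    then show ?thesis
      unfolding x_def y_def eis_eq_products(1)[OF q(1)[OF that]] using Tfun_eq[OF gH[OF that]] by (simp only: q_def)
  qed
  have t0: "3 * x w + y w \<noteq> 0" if "w \<in> U" for w
    unfolding x_def y_def eis_eq_products(1)[OF q(1)[OF that]] using Tq_neq_0 by simp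
  have wt: "w * (3 * x w + y w) = x w - 3 * y w" if "w \<in> U" for w
    unfolding x_def y_def eis_eq_products[OF q(1)[OF that]] wq[OF that] by simp
  have dq: "(q has_field_derivative q w / (- 5 * W w * w)) (at w)" if "w \<in> U" for w
  proof -
    have dg: "(g has_field_derivative deriv g w) (at w)" by (rule holomorphic_derivI[OF U(2,1) that])
    have "((\<lambda>w. ftilde (g w)) has_field_derivative (ftilde (g w) * (- 10 * of_real pi * \<i> * W w)) * deriv g w) (at w)"
      using DERIV_chain2[OF ftilde_has_derivative[OF gH[OF that]] dg] by (simp add: W_def x_def y_def q_def)
    moreover have "((\<lambda>w. ftilde (g w)) has_field_derivative 1) (at w)"
    proof -
      have "\<forall>\<^sub>F v in nhds w. ftilde (g v) = v"
        using eventually_nhds_in_open[OF U(1) that] by eventually_elim (rule inv)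
      then show ?thesis by (rule has_field_derivative_cong_nhds[OF DERIV_ident])
    qed
    ultimately have "(w * (- 10 * of_real pi * \<i> * W w)) * deriv g w = 1"
      using DERIV_unique inv[OF that] by metis
    moreover have "2 * of_real pi * \<i> * deriv g w * (- 5 * W w * w) = (w * (- 10 * of_real pi * \<i> * W w)) * deriv g w"
      by (simp add: algebra_simps)
    ultimately have "2 * of_real pi * \<i> * deriv g w * (- 5 * W w * w) = 1" by (simp only:)
    moreover have "- 5 * W w * w \<noteq> 0" using W[OF that] w0[OF that] by simp
    ultimately have "2 * of_real pi * \<i> * deriv g w = 1 / (- 5 * W w * w)"
      by (rule nonzero_eq_divide_eq[THEN iffD2, rotated])
    moreover have "2 * of_real pi * \<i> * nome (g w) * deriv g w = (2 * of_real pi * \<i> * deriv g w) * q w"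
      by (simp add: q_def)
    ultimately have "2 * of_real pi * \<i> * nome (g w) * deriv g w = q w / (- 5 * W w * w)"
      by (simp only: times_divide_eq_left mult_1_left)
    then show ?thesis unfolding q_def using DERIV_chain2[OF nome_has_derivative dg] by simp
  qed
  have chain: "((\<lambda>w. h (q w)) has_field_derivative D / (- 5 * W w * w)) (at w)"
    if "w \<in> U" "(h has_field_derivative D / q w) (at (q w))" for h D w
    by (rule DERIV_cong[OF DERIV_chain2[OF that(2) dq[OF that(1)]]]) (use q[OF that(1)] in simp)
  have dx: "(x has_field_derivative ((13 * x w ^ 3 - 39 * x w ^ 2 * y w - 47 * x w * y w ^ 2 - 9 * y w ^ 3) / 6 + x w * e w) / (- 5 * W w * w)) (at w)"
    and dy: "(y has_field_derivative ((9 * x w ^ 3 - 47 * x w ^ 2 * y w + 39 * x w * y w ^ 2 + 13 * y w ^ 3) / 6 + y w * e w) / (- 5 * W w * w)) (at w)"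
    and de: "(e has_field_derivative ((5 * x w ^ 4 + 15 * x w ^ 3 * y w - 155 * x w ^ 2 * y w ^ 2 - 15 * x w * y w ^ 3 + 5 * y w ^ 4) / 9 + e w ^ 2) / (- 5 * W w * w)) (at w)"
    if "w \<in> U" for w
    using chain[OF that eis_has_derivative(1)[OF q(2)[OF that] q(1)[OF that]]]
      chain[OF that eis_has_derivative(2)[OF q(2)[OF that] q(1)[OF that]]]
      chain[OF that eis_has_derivative(3)[OF q(2)[OF that] q(1)[OF that]]]
    by (simp_all add: x_def y_def e_def)
  define K where "K = (\<lambda>w. e w + (8 * x w ^ 2 - 30 * x w * y w - 7 * y w ^ 2) / 3)"
  define k where "k = (\<lambda>w. 2 * e w - 5 * (x w ^ 2 + y w ^ 2) / 3)"
  define DK where "DK = (\<lambda>w. K w ^ 2 - 10 * x w * (x w - 3 * y w) * W w)"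
  have dt: "((\<lambda>w. 3 * x w + y w) has_field_derivative (3 * x w + y w) * K w / (- 5 * W w * w)) (at w)" if "w \<in> U" for w
    by (rule DERIV_cong[OF DERIV_add[OF DERIV_cmult[OF dx[OF that]] dy[OF that]]])
       (simp only: times_divide_eq_right add_divide_distrib[symmetric] eis_system_identities(1) K_def)
  have quadratic_form_has_derivative: "((\<lambda>w. a * x w ^ 2 + b * (x w * y w) + c * y w ^ 2) has_field_derivative
      (2 * a * x w * X + b * (X * y w + x w * Y) + 2 * c * y w * Y) / m) (at w)"
    if "(x has_field_derivative X / m) (at w)" "(y has_field_derivative Y / m) (at w)" for a b c X Y m w
    by (rule DERIV_cong, (rule derivative_intros that)+) (simp add: add_divide_distrib algebra_simps)
  have dW: "(W has_field_derivative W w * k w / (- 5 * W w * w)) (at w)"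
    and dK: "(K has_field_derivative DK w / (- 5 * W w * w)) (at w)" if "w \<in> U" for w
  proof -
    define X Y E m where "X = (13 * x w ^ 3 - 39 * x w ^ 2 * y w - 47 * x w * y w ^ 2 - 9 * y w ^ 3) / 6 + x w * e w"
      and "Y = (9 * x w ^ 3 - 47 * x w ^ 2 * y w + 39 * x w * y w ^ 2 + 13 * y w ^ 3) / 6 + y w * e w"
      and "E = (5 * x w ^ 4 + 15 * x w ^ 3 * y w - 155 * x w ^ 2 * y w ^ 2 - 15 * x w * y w ^ 3 + 5 * y w ^ 4) / 9 + e w ^ 2"
      and "m = - 5 * W w * w"
    note defs = X_def[symmetric] Y_def[symmetric] E_def[symmetric] m_def[symmetric]
    note D = dx[OF that, unfolded defs] dy[OF that, unfolded defs] de[OF that, unfolded defs]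
    note I = eis_system_identities[of "x w" "y w" "e w", unfolded defs]
    have "2 * 1 * x w * X + - 4 * (X * y w + x w * Y) + 2 * - 1 * y w * Y
        = 2 * x w * X - 4 * (X * y w + x w * Y) - 2 * y w * Y" by simp
    also have "\<dots> = W w * k w" unfolding I(2) by (simp only: W_def k_def)
    finally have "2 * 1 * x w * X + - 4 * (X * y w + x w * Y) + 2 * - 1 * y w * Y = W w * k w" .
    from DERIV_cong[OF quadratic_form_has_derivative[OF D(1,2)] arg_cong[where f = "\<lambda>z. z / m", OF this]]
    have "(W has_field_derivative W w * k w / m) (at w)"
      by (rule has_field_derivative_cong_nhds) (simp add: W_def)
    then show "(W has_field_derivative W w * k w / (- 5 * W w * w)) (at w)" by (simp only: m_def)
    have "E / m + (2 * (8 / 3) * x w * X + - 10 * (X * y w + x w * Y) + 2 * (- 7 / 3) * y w * Y) / m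
        = (E + (16 * x w * X - 30 * (X * y w + x w * Y) - 14 * y w * Y) / 3) / m"
      by (simp add: add_divide_distrib diff_divide_distrib)
    also have "\<dots> = DK w / m" unfolding I(3) by (simp only: DK_def K_def W_def)
    finally have "E / m + (2 * (8 / 3) * x w * X + - 10 * (X * y w + x w * Y) + 2 * (- 7 / 3) * y w * Y) / m = DK w / m" .
    from DERIV_cong[OF DERIV_add[OF D(3) quadratic_form_has_derivative[OF D(1,2)]] this]
    have "(K has_field_derivative DK w / m) (at w)"
      by (rule has_field_derivative_cong_nhds) (simp add: K_def field_simps)
    then show "(K has_field_derivative DK w / (- 5 * W w * w)) (at w)" by (simp only: m_def)
  qed
  define S where "S = (\<lambda>w. Tfun (g w))"
  define S' where "S' = (\<lambda>w. 2 * \<i> / 5 * ((3 * x w + y w) * K w / (W w * w)))"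
  have dS: "(S has_field_derivative S' w) (at w)" if "w \<in> U" for w
  proof -
    have ev: "\<forall>\<^sub>F v in nhds w. S v = - 2 * \<i> * (3 * x v + y v)"
      using eventually_nhds_in_open[OF U(1) that] unfolding S_def by eventually_elim (rule T)
    have "((\<lambda>v. - 2 * \<i> * (3 * x v + y v)) has_field_derivative S' w) (at w)"
      by (rule DERIV_cong[OF DERIV_cmult[OF dt[OF that]]])
         (use W[OF that] w0[OF that] in \<open>simp add: S'_def field_simps\<close>)
    then show ?thesis using ev by (rule has_field_derivative_cong_nhds)
  qed
  show "(\<lambda>w. Tfun (g w)) holomorphic_on U"
    using dS U(1) unfolding S_def[symmetric] by (auto simp: holomorphic_on_open)
  have dS': "(S' has_field_derivative 2 * \<i> / 5 * ((3 * x w + y w) * (- (K w ^ 2 + DK w) / 5 - K w * W w + K w * k w / 5) / (W w * w) ^ 2)) (at w)"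
    if "w \<in> U" for w
  proof -
    have nz: "W w * w \<noteq> 0" using W[OF that] w0[OF that] by simp
    have "((t * K' / (- 5 * V * w) * K' + DK' / (- 5 * V * w) * t) * (V * w) - t * K' * (V * k' / (- 5 * V * w) * w + 1 * V)) / (V * w * (V * w))
        = t * (- (K' ^ 2 + DK') / 5 - K' * V + K' * k' / 5) / (V * w) ^ 2"
      if "V * w \<noteq> 0" for t K' V DK' k' :: complex
      using that by (simp add: divide_simps) (simp add: algebra_simps power2_eq_square)
    from this[OF nz] show ?thesis
      unfolding S'_def
      by (intro DERIV_cmult DERIV_cong[OF DERIV_divide[OF DERIV_mult[OF dt[OF that] dK[OF that]] DERIV_mult[OF dW[OF that] DERIV_ident] nz]])
  qed
  fix w assume w: "w \<in> U"
  have "(deriv ^^ 2) S w = deriv (deriv S) w" by (simp add: numeral_2_eq_2)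
  also have "\<dots> = deriv S' w"
  proof (rule deriv_cong_ev)
    show "\<forall>\<^sub>F v in nhds w. deriv S v = S' v"
      using eventually_nhds_in_open[OF U(1) w] by eventually_elim (rule DERIV_imp_deriv[OF dS])
  qed simp
  also have "\<dots> = 2 * \<i> / 5 * ((3 * x w + y w) * (- (K w ^ 2 + DK w) / 5 - K w * W w + K w * k w / 5) / (W w * w) ^ 2)"
    by (rule DERIV_imp_deriv[OF dS'[OF w]])
  finally have S2: "(deriv ^^ 2) S w = 2 * \<i> / 5 * ((3 * x w + y w) * (- (K w ^ 2 + DK w) / 5 - K w * W w + K w * k w / 5) / (W w * w) ^ 2)" .
  have S1: "deriv S w = 2 * \<i> / 5 * ((3 * x w + y w) * K w / (W w * w))"
    using DERIV_imp_deriv[OF dS[OF w]] by (simp add: S'_def)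
  have S0: "S w = - 2 * \<i> * (3 * x w + y w)" using T[OF w] by (simp add: S_def)
  note ode = ode_identity(1)[OF wt[OF w] t0[OF w] w0[OF w] W[OF w, unfolded W_def]]
    ode_identity(2)[OF wt[OF w] t0[OF w] w0[OF w] W[OF w, unfolded W_def], of "e w"]
  have Q: "w ^ 2 + 11 * w - 1 \<noteq> 0" 
    using W[OF w] t0[OF w] unfolding ode(1) W_def by (simp only: mult_eq_0_iff divide_eq_0_iff power_eq_0_iff) simp
  then have ne: "w - of_real sing_plus \<noteq> 0" "w - of_real sing_minus \<noteq> 0" unfolding sing_quadratic[symmetric] by auto
  have "1 / (w - of_real sing_plus) + 1 / (w - of_real sing_minus) = (2 * w + 11) / (w ^ 2 + 11 * w - 1)"
  proof -
    have "1 / (w - of_real sing_plus) + 1 / (w - of_real sing_minus)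
        = ((w - of_real sing_plus) + (w - of_real sing_minus)) / ((w - of_real sing_plus) * (w - of_real sing_minus))"
      using ne by (simp add: add_frac_eq add.commute)
    also have "(w - of_real sing_plus) + (w - of_real sing_minus) = 2 * w + 11"
    proof -
      have "sing_plus + sing_minus = - 11" by (simp add: sing_plus_def sing_minus_def field_simps)
      then have "complex_of_real sing_plus + of_real sing_minus = - 11" unfolding of_real_add[symmetric] by simp
      then show ?thesis by (simp add: algebra_simps)
    qed
    finally show ?thesis unfolding sing_quadratic .
  qed
  note frac = this
  have collect: "2 * \<i> / 5 * a + b * (2 * \<i> / 5 * c) + n / m * (- 2 * \<i> * t)
      = 2 * \<i> / 5 * (a + b * c - 5 * n / m * t)" for a b c n m t :: complex
  proof -
    have core: "I * a + b * (I * c) + d * (- (5 * I) * t) = I * (a + b * c - 5 * d * t)" for I d :: complex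
      by (simp add: algebra_simps)
    have I: "- (5 * (2 * \<i>) / 5) = - 2 * \<i>" by simp
    show ?thesis
      using core[of "2 * \<i> / 5" "n / m"] unfolding times_divide_eq_right I .
  qed
  have "(deriv ^^ 2) S w + (1 / w + 1 / (w - of_real sing_plus) + 1 / (w - of_real sing_minus)) * deriv S w
      + (w + 3) / (w * (w - of_real sing_plus) * (w - of_real sing_minus)) * S w
      = 2 * \<i> / 5 * ((3 * x w + y w) * (- (K w ^ 2 + DK w) / 5 - K w * W w + K w * k w / 5) / (W w * w) ^ 2
      + (1 / w + (2 * w + 11) / (w ^ 2 + 11 * w - 1)) * ((3 * x w + y w) * K w / (W w * w))
      - 5 * (w + 3) / (w * (w ^ 2 + 11 * w - 1)) * (3 * x w + y w))"
    unfolding S0 S1 S2 mult.assoc[of w] sing_quadratic add.assoc[of "1 / w"] frac by (rule collect)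
  also have "\<dots> = 0"
    using ode(2) unfolding K_def k_def DK_def W_def by simp
  finally show "w \<noteq> 0 \<and> w \<noteq> of_real sing_plus \<and> w \<noteq> of_real sing_minus \<and>
               (deriv ^^ 2) (\<lambda>w. Tfun (g w)) w
               + (1 / w + 1 / (w - of_real sing_plus) + 1 / (w - of_real sing_minus))
                   * deriv (\<lambda>w. Tfun (g w)) w
               + (w + 3) / (w * (w - of_real sing_plus) * (w - of_real sing_minus))
                   * Tfun (g w) = 0"
    using w0[OF w] ne unfolding S_def by auto
qed

theorem theorem6p8:
  shows "(\<forall>\<tau>\<in>upper_half_plane. \<exists>U g.
            local_holomorphic_inverse ftilde upper_half_plane U g \<and>
            ftilde \<tau> \<in> U \<and> g (ftilde \<tau>) = \<tau>) \<and>
         (\<forall>U g. local_holomorphic_inverse ftilde upper_half_plane U g \<longrightarrow>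
            (\<lambda>w. Tfun (g w)) holomorphic_on U \<and>
            (\<forall>w\<in>U.
               w \<noteq> 0 \<and> w \<noteq> of_real sing_plus \<and> w \<noteq> of_real sing_minus \<and>
               (deriv ^^ 2) (\<lambda>w. Tfun (g w)) w
               + (1 / w + 1 / (w - of_real sing_plus) + 1 / (w - of_real sing_minus))
                   * deriv (\<lambda>w. Tfun (g w)) w
               + (w + 3) / (w * (w - of_real sing_plus) * (w - of_real sing_minus))
                   * Tfun (g w) = 0))"
  using ftilde_local_inverse_exists Tfun_inverse_ode by blast

end
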